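(* Let $f$ denote the second-order correlation function of the characteristic polynomial of an unrescaled complex sample covariance matrix, and let $b^*:=2\left(b-\tfrac34\right)$. For any $\alpha\in\mathbb{N}$ and any positive real numbers $\mu,\nu$, put $n:=N$, $m:=N-\alpha$, and $Z_N(\mu,\nu):=(\mu\nu/N^2)^{\alpha/2}$. Then $$ \lim_{N\to\infty}\left(\frac14\,N^{-1}\,Z_N(\mu/4,\nu/4)\cdot\frac{f\big(n,m;\tfrac{\mu}{4N},\tfrac{\nu}{4N}\big)}{n!\,m!}\right)=\exp(b^* )\,\mathbb{J}_\alpha(\mu,\nu). $$
   Context: Here $\mathbb{N}=\{0,1,2,\dots\}$ and $\alpha$ is fixed as $N\to\infty$ ($N\ge\alpha$). Let $Q$ be a probability distribution on the real line with expectation $0$, variance $1/2$ and finite fourth moment $b$ (i.e. $b=\int x^4\,dQ(x)<\infty$). For $n\ge m$, let $X=X(n,m)$ be the $n\times m$ random matrix whose entries are i.i.d. complex random variables whose real and imaginary parts are independent, each with distribution $Q$, and let $X^*$ be its conjugate transpose. The $m\times m$ matrix $X(n,m)^*X(n,m)$ is the unrescaled complex sample covariance matrix. For $\mu,\nu\in\mathbb{C}$, $$ f(n,m;\mu,\nu):=\mathbb{E}\big(\det(X(n,m)^*X(n,m)-\mu)\,\det(X(n,m)^*X(n,m)-\nu)\big), $$ where $\mu,\nu$ inside the determinants stand for $\mu I_m,\nu I_m$. With $J_\alpha$ the Bessel function of the first kind of order $\alpha$, the Bessel kernel is $$ \mathbb{J}_\alpha(x,y):=\frac{J_\alpha(\sqrt{x})\,\sqrt{y}\,J_\alpha'(\sqrt{y})-\sqrt{x}\,J_\alpha'(\sqrt{x})\,J_\alpha(\sqrt{y})}{2(x-y)},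 $$ understood for $x=y$ as its continuous extension. *)

theory Defs
  imports "HOL-Probability.Probability" "Jordan_Normal_Form.Schur_Decomposition"
begin

text \<open>\<open>X\<close> is an \<open>n \<times> m\<close> complex random matrix on the probability space \<open>M\<close>
  with independent entries whose real and imaginary parts are independent with distribution \<open>Q\<close>.
  The entries are then automatically identically distributed.\<close>

definition iid_complex_matrix ::
    "real measure \<Rightarrow> 'w measure \<Rightarrow> nat \<Rightarrow> nat \<Rightarrow> ('w \<Rightarrow> complex mat) \<Rightarrow> bool" where
  "iid_complex_matrix Q M n m X \<longleftrightarrow>
     prob_space M \<and>
     (\<forall>\<omega>\<in>space M. X \<omega> \<in> carrier_mat n m) \<and>
     prob_space.indep_vars M (\<lambda>_. borel) (\<lambda>ij \<omega>. X \<omega> $$ ij) ({..<n} \<times> {..<m}) \<and>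
     (\<forall>i<n. \<forall>j<m.
        prob_space.indep_var M borel (\<lambda>\<omega>. Re (X \<omega> $$ (i, j))) borel (\<lambda>\<omega>. Im (X \<omega> $$ (i, j))) \<and>
        distr M borel (\<lambda>\<omega>. Re (X \<omega> $$ (i, j))) = Q \<and>
        distr M borel (\<lambda>\<omega>. Im (X \<omega> $$ (i, j))) = Q)"

definition sample_covariance :: "complex mat \<Rightarrow> complex mat" where
  "sample_covariance A = mat_adjoint A * A"

text \<open>The determinant is the one for matrices of arbitrary carrier dimension; the
  type-indexed determinant of \<open>HOL-Analysis\<close> has the same base name.\<close>

definition char_poly_correlation ::
    "(nat \<Rightarrow> nat \<Rightarrow> 'w measure) \<Rightarrow> (nat \<Rightarrow> nat \<Rightarrow> 'w \<Rightarrow> complex mat) \<Rightarrow>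
     nat \<Rightarrow> nat \<Rightarrow> complex \<Rightarrow> complex \<Rightarrow> complex" where
  "char_poly_correlation M X n m \<mu> \<nu> =
     (\<integral>\<omega>. Determinant.det (sample_covariance (X n m \<omega>) - \<mu> \<cdot>\<^sub>m 1\<^sub>m m) *
           Determinant.det (sample_covariance (X n m \<omega>) - \<nu> \<cdot>\<^sub>m 1\<^sub>m m) \<partial>(M n m))"

definition bessel_J :: "nat \<Rightarrow> real \<Rightarrow> real" where
  "bessel_J \<alpha> x = (\<Sum>k. (-1) ^ k / (fact k * fact (k + \<alpha>)) * (x / 2) ^ (2 * k + \<alpha>))"

definition bessel_quotient :: "nat \<Rightarrow> real \<Rightarrow> real \<Rightarrow> real" where
  "bessel_quotient \<alpha> x y =
     (bessel_J \<alpha> (sqrt x) * sqrt y * deriv (bessel_J \<alpha>) (sqrt y)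
      - sqrt x * deriv (bessel_J \<alpha>) (sqrt x) * bessel_J \<alpha> (sqrt y)) / (2 * (x - y))"

text \<open>On the diagonal the kernel is the joint limit of the quotient from off-diagonal points
  of the positive quadrant, i.e. its continuous extension.\<close>

definition bessel_kernel :: "nat \<Rightarrow> real \<Rightarrow> real \<Rightarrow> real" where
  "bessel_kernel \<alpha> x y =
     (if x \<noteq> y then bessel_quotient \<alpha> x y
      else Lim (at (x, x) within {(s, t). 0 < s \<and> 0 < t \<and> s \<noteq> t})
             (\<lambda>(s, t). bessel_quotient \<alpha> s t))"

definition Z_norm :: "nat \<Rightarrow> nat \<Rightarrow> real \<Rightarrow> real \<Rightarrow> real" where
  "Z_norm \<alpha> N \<mu> \<nu> = (\<mu> * \<nu> / (real N)\<^sup>2) powr (real \<alpha> / 2)"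

end

theory Submission
  imports Defs "HOL-Real_Asymp.Real_Asymp"
begin

text \<open>
  Expanding both determinants into permutations and averaging, only pairings of the entries survive,
  because the entries \<open>x\<close> satisfy \<open>E x = E x\<^sup>2 = 0\<close>, \<open>E \<bar>x\<bar>\<^sup>2 = 1\<close> and \<open>E \<bar>x\<bar>\<^sup>4 = 2 + B\<close> with
  \<open>B = 2 (b - 3/4)\<close>. In each column occurring in both determinants the factors are paired within
  each determinant, or across the two determinants, or contribute the fourth cumulant \<open>B\<close>. If the
  second case occurs on a set \<open>A\<close> of columns, the two permutations restrict to mutually inverse
  permutations of \<open>A\<close>, so all signs are positive and the expectation reduces to counting
  injections. With \<open>\<alpha> = n - m\<close> this gives
  \<open>f(n,m;\<mu>,\<nu>) / (n! m!) = \<Sum> B\<^sup>d/d! * (r+\<alpha>)!/r! * L\<^sub>r(\<mu>) L\<^sub>r(\<nu>)\<close>, summed over \<open>d + r \<le> m\<close>, where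
  \<open>L\<^sub>r(z) = \<Sum>\<^sub>p (r choose p) (-z)\<^sup>p/(p+\<alpha>)!\<close>: a Christoffel-Darboux sum of Laguerre polynomials, smeared
  by the cumulant. After rescaling, dominated convergence in the triple series indexed by \<open>d\<close> and the
  two powers \<open>p\<close>, \<open>q\<close> gives \<open>exp B\<close> times a double power series with denominators \<open>\<alpha>+p+q+1\<close>, which
  the recursion of the Bessel coefficients identifies with the Bessel kernel.
\<close>

subsection \<open>Determinants of shifted Gram matrices\<close>

text \<open>The difficulty is to keep products of four kinds of entries in a form to which
  independence applies. Inverting the permutation in a Leibniz term places both factors with index
  \<open>j\<close> in column \<open>j\<close>, at the rows \<open>\<sigma> j\<close> and
  \<open>\<sigma> (\<pi> j)\<close>, and cancellation as in Cauchy-Binet leaves only injective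
  \<sigma>. A column then carries at most one conjugated and one plain factor from each determinant,
  so fourth moments are the highest that occur. Since E |x|^4 = 2 b + 1/2, the constant B is the
  excess over the value 2 of a complex Gaussian entry, for which b = 3/4. The a columns paired
  across the determinants carry a! permutations, which cancel the a! from the choice of these
  columns; cumulant columns carry none, so d! survives. In terms of r = m - a - d, a fixed d only
  lowers the end of the range of r by d, which is invisible at scale N. Hence all d have the same
  limit and the cumulant factors out as exp B.\<close>

definition inj_maps :: "nat set \<Rightarrow> nat set \<Rightarrow> (nat \<Rightarrow> nat) set" where
  "inj_maps S T = {\<sigma> \<in> S \<rightarrow>\<^sub>E T. inj_on \<sigma> S}"

lemma sample_covariance_carrier:
  assumes "A \<in> carrier_mat n m"
  shows "sample_covariance A \<in> carrier_mat m m"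
  using assms by (auto simp: sample_covariance_def mat_adjoint_def)

lemma sample_covariance_index:
  assumes "A \<in> carrier_mat n m" "i < m" "j < m"
  shows "sample_covariance A $$ (i, j) = (\<Sum>k<n. cnj (A $$ (k, i)) * A $$ (k, j))"
  using assms
  by (auto simp: sample_covariance_def mat_adjoint_def scalar_prod_def mat_of_rows_index
      atLeast0LessThan intro!: sum.cong)

text \<open>A transposition of two points with the same image under \<sigma> reverses the sign and
  leaves the product unchanged, as for a determinant with two equal rows; the sum is its own
  negative.\<close>

lemma sum_sign_permutes_eq_0:
  fixes \<sigma> :: "nat \<Rightarrow> 'b" and f :: "'b \<Rightarrow> nat \<Rightarrow> complex"
  assumes "finite S" "\<not> inj_on \<sigma> S"
  shows "(\<Sum>\<pi> | \<pi> permutes S. of_int (sign \<pi>) * (\<Prod>j\<in>S. f (\<sigma> (\<pi> j)) j)) = 0"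
proof -
  obtain a b where ab: "a \<in> S" "b \<in> S" "a \<noteq> b" "\<sigma> a = \<sigma> b"
    using assms(2) by (auto simp: inj_on_def)
  let ?t = "Transposition.transpose a b"
  let ?h = "\<lambda>\<pi>. of_int (sign \<pi>) * (\<Prod>j\<in>S. f (\<sigma> (\<pi> j)) j) :: complex"
  have t: "?t permutes S" using ab by (intro permutes_swap_id)
  have "(\<Sum>\<pi> | \<pi> permutes S. ?h \<pi>) = (\<Sum>\<pi> | \<pi> permutes S. ?h (?t \<circ> \<pi>))"
    by (rule setum_permutations_compose_left[OF t]) 
  also have "\<dots> = (\<Sum>\<pi> | \<pi> permutes S. - ?h \<pi>)"
  proof (intro sum.cong refl)
    fix \<pi> assume "\<pi> \<in> {\<pi>. \<pi> permutes S}"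
    hence p: "permutation \<pi>" using assms(1) by (auto simp: permutation_permutes)
    have s: "sign (?t \<circ> \<pi>) = - sign \<pi>"
      using ab p by (simp add: sign_compose permutation_swap_id sign_swap_id)
    have "\<sigma> (?t x) = \<sigma> x" for x
      using ab by (auto simp: Transposition.transpose_def)
    thus "?h (?t \<circ> \<pi>) = - ?h \<pi>" by (simp add: s)
  qed
  finally show ?thesis by (simp add: sum_negf)
qed

text \<open>This is Cauchy-Binet kept at the level of single terms. On the right all factors with
  index \<open>j\<close> lie in column \<open>j\<close>, which is what lets an expectation over
  independent entries split column by column.\<close>

lemma sum_permutes_expand:
  fixes X :: "nat \<Rightarrow> nat \<Rightarrow> complex"
  assumes "finite S"
  shows "(\<Sum>\<pi> | \<pi> permutes S. of_int (sign \<pi>) * (\<Prod>j\<in>S. \<Sum>i<n. cnj (X i j) * X i (\<pi> j))) =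
    (\<Sum>\<sigma>\<in>inj_maps S {..<n}. \<Sum>\<pi> | \<pi> permutes S.
        of_int (sign \<pi>) * (\<Prod>j\<in>S. cnj (X (\<sigma> j) j) * X (\<sigma> (\<pi> j)) j))"
proof -
  let ?P = "{\<pi>. \<pi> permutes S}"
  let ?E = "S \<rightarrow>\<^sub>E {..<n}"
  have fE: "finite ?E" using assms by (intro finite_PiE) auto
  have "(\<Sum>\<pi>\<in>?P. of_int (sign \<pi>) * (\<Prod>j\<in>S. \<Sum>i<n. cnj (X i j) * X i (\<pi> j))) =
     (\<Sum>\<pi>\<in>?P. \<Sum>\<sigma>\<in>?E. of_int (sign \<pi>) * (\<Prod>j\<in>S. cnj (X (\<sigma> j) j) * X (\<sigma> j) (\<pi> j)))"
    using assms by (intro sum.cong refl) (simp add: prod_sum_PiE sum_distrib_left)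
  also have "\<dots> = (\<Sum>\<sigma>\<in>?E. \<Sum>\<pi>\<in>?P. of_int (sign \<pi>) * (\<Prod>j\<in>S. cnj (X (\<sigma> j) j) * X (\<sigma> j) (\<pi> j)))"
    by (rule sum.swap)
  also have "\<dots> = (\<Sum>\<sigma>\<in>?E. \<Sum>\<pi>\<in>?P. of_int (sign \<pi>) * (\<Prod>j\<in>S. cnj (X (\<sigma> j) j) * X (\<sigma> (\<pi> j)) j))"
  proof (rule sum.cong[OF refl])
    fix \<sigma>
    \<comment> \<open>Replacing \<pi> by its inverse preserves the sign; reindexing the product over
      \<open>S\<close> by \<pi> then moves the permutation from the column index to the row
      index.\<close>
    have "(\<Sum>\<pi>\<in>?P. of_int (sign \<pi>) * (\<Prod>j\<in>S. cnj (X (\<sigma> j) j) * X (\<sigma> j) (\<pi> j))) =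
      (\<Sum>\<pi>\<in>?P. of_int (sign (inv_into UNIV \<pi>)) * (\<Prod>j\<in>S. cnj (X (\<sigma> j) j) * X (\<sigma> j) (inv_into UNIV \<pi> j)))"
      by (rule sum_permutations_inverse)
    also have "\<dots> = (\<Sum>\<pi>\<in>?P. of_int (sign \<pi>) * (\<Prod>j\<in>S. cnj (X (\<sigma> j) j) * X (\<sigma> (\<pi> j)) j))"
    proof (intro sum.cong refl)
      fix \<pi> assume "\<pi> \<in> ?P"
      hence p: "\<pi> permutes S" by simp
      have "sign (inv_into UNIV \<pi>) = sign \<pi>"
        using p assms by (intro sign_inverse) (auto simp: permutation_permutes)
      moreover have "(\<Prod>j\<in>S. X (\<sigma> j) (inv_into UNIV \<pi> j)) = (\<Prod>j\<in>S. X (\<sigma> (\<pi> j)) j)"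
        by (subst prod.permute[OF p]) (simp add: o_def permutes_inverses[OF p])
      ultimately show "of_int (sign (inv_into UNIV \<pi>)) * (\<Prod>j\<in>S. cnj (X (\<sigma> j) j) * X (\<sigma> j) (inv_into UNIV \<pi> j)) =
        of_int (sign \<pi>) * (\<Prod>j\<in>S. cnj (X (\<sigma> j) j) * X (\<sigma> (\<pi> j)) j)"
        by (simp add: prod.distrib)
    qed
    finally show "(\<Sum>\<pi>\<in>?P. of_int (sign \<pi>) * (\<Prod>j\<in>S. cnj (X (\<sigma> j) j) * X (\<sigma> j) (\<pi> j))) =
      (\<Sum>\<pi>\<in>?P. of_int (sign \<pi>) * (\<Prod>j\<in>S. cnj (X (\<sigma> j) j) * X (\<sigma> (\<pi> j)) j))" .
  qed
  also have "\<dots> = (\<Sum>\<sigma>\<in>inj_maps S {..<n}. \<Sum>\<pi>\<in>?P.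
        of_int (sign \<pi>) * (\<Prod>j\<in>S. cnj (X (\<sigma> j) j) * X (\<sigma> (\<pi> j)) j))"
  proof (intro sum.mono_neutral_right fE ballI)
    fix \<sigma> assume "\<sigma> \<in> ?E - inj_maps S {..<n}"
    hence "\<not> inj_on \<sigma> S" by (auto simp: inj_maps_def)
    from sum_sign_permutes_eq_0[OF assms this, of X]
    have "(\<Prod>j\<in>S. cnj (X (\<sigma> j) j)) * (\<Sum>\<pi>\<in>?P. of_int (sign \<pi>) * (\<Prod>j\<in>S. X (\<sigma> (\<pi> j)) j)) = 0"
      by simp
    thus "(\<Sum>\<pi>\<in>?P. of_int (sign \<pi>) * (\<Prod>j\<in>S. cnj (X (\<sigma> j) j) * X (\<sigma> (\<pi> j)) j)) = 0"
      by (simp add: sum_distrib_left prod.distrib algebra_simps)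
  qed (auto simp: inj_maps_def)
  finally show ?thesis .
qed

text \<open>Each row of a Leibniz product takes either a Gram entry or the diagonal term
  \<open>- z\<close>. With \<open>S\<close> the set of rows taking Gram entries, this is the
  expansion into principal minors.\<close>

lemma det_sample_covariance_expand:
  assumes A: "A \<in> carrier_mat n m"
  shows "Determinant.det (sample_covariance A - z \<cdot>\<^sub>m 1\<^sub>m m) =
    (\<Sum>S\<in>Pow {..<m}. (- z) ^ (m - card S) * (\<Sum>\<sigma>\<in>inj_maps S {..<n}. \<Sum>\<pi> | \<pi> permutes S.
        of_int (sign \<pi>) * (\<Prod>j\<in>S. cnj (A $$ (\<sigma> j, j)) * A $$ (\<sigma> (\<pi> j), j))))"
proof -
  let ?X = "\<lambda>i j. A $$ (i, j)"
  define W where "W = (\<lambda>i j. \<Sum>k<n. cnj (?X k i) * ?X k j)"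
  have c: "sample_covariance A - z \<cdot>\<^sub>m 1\<^sub>m m \<in> carrier_mat m m"
    using sample_covariance_carrier[OF A] by auto
  have "Determinant.det (sample_covariance A - z \<cdot>\<^sub>m 1\<^sub>m m) =
    (\<Sum>\<pi> | \<pi> permutes {..<m}. of_int (sign \<pi>) *
       (\<Prod>j<m. W j (\<pi> j) + (if \<pi> j = j then - z else 0)))"
    unfolding det_def'[OF c] atLeast0LessThan
  proof (intro sum.cong refl arg_cong2[where f = "(*)"] prod.cong)
    fix \<pi> j assume "\<pi> \<in> {\<pi>. \<pi> permutes {..<m}}" "j \<in> {..<m}"
    hence "\<pi> j < m" "j < m" using permutes_in_image[of \<pi> "{..<m}" j] by auto
    thus "(sample_covariance A - z \<cdot>\<^sub>m 1\<^sub>m m) $$ (j, \<pi> j) =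
      W j (\<pi> j) + (if \<pi> j = j then - z else 0)"
      using sample_covariance_carrier[OF A]
      by (auto simp: sample_covariance_index[OF A] W_def)
  qed
  also have "\<dots> = (\<Sum>\<pi> | \<pi> permutes {..<m}. \<Sum>S\<in>Pow {..<m}. of_int (sign \<pi>) *
       ((\<Prod>j\<in>S. W j (\<pi> j)) * (\<Prod>j\<in>{..<m} - S. if \<pi> j = j then - z else 0)))"
    by (simp add: prod_add sum_distrib_left)
  also have "\<dots> = (\<Sum>S\<in>Pow {..<m}. \<Sum>\<pi> | \<pi> permutes {..<m}. of_int (sign \<pi>) *
       ((\<Prod>j\<in>S. W j (\<pi> j)) * (\<Prod>j\<in>{..<m} - S. if \<pi> j = j then - z else 0)))"
    by (rule sum.swap)
  also have "\<dots> = (\<Sum>S\<in>Pow {..<m}. (- z) ^ (m - card S) * (\<Sum>\<sigma>\<in>inj_maps S {..<n}. \<Sum>\<pi> | \<pi> permutes S.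
        of_int (sign \<pi>) * (\<Prod>j\<in>S. cnj (A $$ (\<sigma> j, j)) * A $$ (\<sigma> (\<pi> j), j))))"
  proof (rule sum.cong[OF refl])
    fix S assume "S \<in> Pow {..<m}"
    hence S: "S \<subseteq> {..<m}" "finite S" by (auto intro: finite_subset)
    have "(\<Sum>\<pi> | \<pi> permutes {..<m}. of_int (sign \<pi>) *
       ((\<Prod>j\<in>S. W j (\<pi> j)) * (\<Prod>j\<in>{..<m} - S. if \<pi> j = j then - z else 0))) =
      (\<Sum>\<pi> | \<pi> permutes S. of_int (sign \<pi>) *
       ((\<Prod>j\<in>S. W j (\<pi> j)) * (\<Prod>j\<in>{..<m} - S. if \<pi> j = j then - z else 0)))"
    proof (intro sum.mono_neutral_right ballI)
      show "{\<pi>. \<pi> permutes S} \<subseteq> {\<pi>. \<pi> permutes {..<m}}"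
        using S by (auto intro: permutes_subset)
      fix \<pi> assume "\<pi> \<in> {\<pi>. \<pi> permutes {..<m}} - {\<pi>. \<pi> permutes S}"
      \<comment> \<open>A moved point outside \<open>S\<close> meets an off-diagonal entry of the
        scalar matrix, which is 0.\<close>
      then obtain j where "j \<in> {..<m} - S" "\<pi> j \<noteq> j"
        using permutes_superset[of \<pi> "{..<m}" S] by auto
      hence "(\<Prod>j\<in>{..<m} - S. if \<pi> j = j then - z else 0) = 0"
        by (intro prod_zero) auto
      thus "of_int (sign \<pi>) * ((\<Prod>j\<in>S. W j (\<pi> j)) *
        (\<Prod>j\<in>{..<m} - S. if \<pi> j = j then - z else 0)) = 0" by simp
    qed (simp add: finite_permutations)
    also have "\<dots> = (\<Sum>\<pi> | \<pi> permutes S. (- z) ^ (m - card S) *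
       (of_int (sign \<pi>) * (\<Prod>j\<in>S. W j (\<pi> j))))"
    proof (intro sum.cong refl)
      fix \<pi> assume "\<pi> \<in> {\<pi>. \<pi> permutes S}"
      hence "(\<Prod>j\<in>{..<m} - S. if \<pi> j = j then - z else 0) = (\<Prod>j\<in>{..<m} - S. - z)"
        by (intro prod.cong refl) (auto simp: permutes_def)
      also have "\<dots> = (- z) ^ (m - card S)"
        using S by (simp add: card_Diff_subset)
      finally show "of_int (sign \<pi>) * ((\<Prod>j\<in>S. W j (\<pi> j)) *
          (\<Prod>j\<in>{..<m} - S. if \<pi> j = j then - z else 0)) =
        (- z) ^ (m - card S) * (of_int (sign \<pi>) * (\<Prod>j\<in>S. W j (\<pi> j)))"
        by simp
    qed
    finally show "(\<Sum>\<pi> | \<pi> permutes {..<m}. of_int (sign \<pi>) *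
       ((\<Prod>j\<in>S. W j (\<pi> j)) * (\<Prod>j\<in>{..<m} - S. if \<pi> j = j then - z else 0))) =
      (- z) ^ (m - card S) * (\<Sum>\<sigma>\<in>inj_maps S {..<n}. \<Sum>\<pi> | \<pi> permutes S.
        of_int (sign \<pi>) * (\<Prod>j\<in>S. cnj (A $$ (\<sigma> j, j)) * A $$ (\<sigma> (\<pi> j), j)))"
      unfolding W_def sum_permutes_expand[OF S(2), where n = n and X = ?X, symmetric]
      by (simp add: sum_distrib_left)
  qed
  finally show ?thesis .
qed

subsection \<open>Pairings of matrix entries\<close>

lemma prod_of_bool: "finite A \<Longrightarrow> (\<Prod>x\<in>A. of_bool (P x)) = (of_bool (\<forall>x\<in>A. P x) :: 'a :: comm_semiring_1)"
  by (induction A rule: finite_induct) auto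

text \<open>Exponents 0 and 1 spread the product over all cells of the matrix. Several such products
  can then be merged by adding exponents, cell by cell, before independence is applied.\<close>

lemma prod_graph_eq_prod_cells:
  fixes F :: "nat \<Rightarrow> nat \<Rightarrow> 'a :: comm_semiring_1"
  assumes "S \<subseteq> {..<m}" "\<And>j. j \<in> S \<Longrightarrow> \<sigma> j < n"
  shows "(\<Prod>j\<in>S. F (\<sigma> j) j) = (\<Prod>j<m. \<Prod>i<n. F i j ^ of_bool (j \<in> S \<and> \<sigma> j = i))"
proof -
  have "(\<Prod>i<n. F i j ^ of_bool (j \<in> S \<and> \<sigma> j = i)) = (if j \<in> S then F (\<sigma> j) j else 1)" for j
  proof (cases "j \<in> S")
    case True
    have "(\<Prod>i<n. F i j ^ of_bool (j \<in> S \<and> \<sigma> j = i)) = (\<Prod>i<n. if \<sigma> j = i then F i j else 1)"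
      using True by (intro prod.cong refl) auto
    thus ?thesis using True assms(2) by (simp add: prod.delta)
  qed simp
  hence "(\<Prod>j<m. \<Prod>i<n. F i j ^ of_bool (j \<in> S \<and> \<sigma> j = i)) = (\<Prod>j<m. if j \<in> S then F (\<sigma> j) j else 1)"
    by simp
  also have "\<dots> = (\<Prod>j\<in>S. F (\<sigma> j) j)"
    using assms(1) by (intro prod.mono_neutral_cong_right) auto
  finally show ?thesis ..
qed

text \<open>Third moments never contribute: a cell with three factors leaves an unpaired factor in
  another cell of the column.\<close>
lemma wick_column:
  fixes mom :: "nat \<Rightarrow> nat \<Rightarrow> nat \<Rightarrow> 'a :: comm_ring_1" and n s t s' t' :: nat
  assumes mom: "\<And>i. i < n \<Longrightarrow> mom i 0 0 = 1 \<and> mom i 1 0 = 0 \<and> mom i 0 1 = 0 \<and> mom i 1 1 = 1 \<and>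
      mom i 2 0 = 0 \<and> mom i 0 2 = 0 \<and> mom i 2 2 = 2 + B"
    and P: "P \<Longrightarrow> s < n \<and> s' < n" and Q: "Q \<Longrightarrow> t < n \<and> t' < n"
  shows "(\<Prod>i<n. mom i (of_bool (P \<and> s = i) + of_bool (Q \<and> t = i))
                     (of_bool (P \<and> s' = i) + of_bool (Q \<and> t' = i))) =
     of_bool (P \<and> Q \<and> s = t' \<and> t = s') + (B * of_bool (P \<and> Q \<and> s = t \<and> s = s' \<and> t = t') +
     of_bool ((P \<longrightarrow> s = s') \<and> (Q \<longrightarrow> t = t')))"
    (is "prod ?f _ = ?rhs")
proof -
  have mom': "mom i 0 (Suc 0) = 0" "mom i (Suc 0) 0 = 0" "mom i (Suc 0) (Suc 0) = 1" if "i < n" for i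
    using mom[OF that] by auto
  have z: "prod ?f {..<n} = 0" if "i < n" "?f i = 0" for i
    by (rule prod_zero[OF finite_lessThan]) (use that in blast)
  have o: "prod ?f {..<n} = 1" if "\<And>i. i < n \<Longrightarrow> ?f i = 1"
    by (rule prod.neutral) (use that in blast)
  consider "\<not> P" "\<not> Q" | "P" "\<not> Q" | "\<not> P" "Q" | "P" "Q" by blast
  thus ?thesis
  proof cases
    case 1
    thus ?thesis using o mom by auto
  next
    case 2
    show ?thesis
    proof (cases "s = s'")
      case True
      have "prod ?f {..<n} = 1" using True 2 mom mom' by (intro o) auto
      thus ?thesis using 2 True by simp
    next
      case False
      have "prod ?f {..<n} = 0" using False 2 mom mom' P by (intro z[of s]) auto
      thus ?thesis using 2 False by simp
    qed
  next
    case 3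
    show ?thesis
    proof (cases "t = t'")
      case True
      have "prod ?f {..<n} = 1" using True 3 mom mom' by (intro o) auto
      thus ?thesis using 3 True by simp
    next
      case False
      have "prod ?f {..<n} = 0" using False 3 mom mom' Q by (intro z[of t]) auto
      thus ?thesis using 3 False by simp
    qed
  next
    case 4
    note lt = P[OF 4(1)] Q[OF 4(2)]
    show ?thesis
    proof (cases "s = t")
      case True
      consider "s' \<noteq> s" | "t' \<noteq> s" | "s' = s" "t' = s" by blast
      thus ?thesis
      proof cases
        case 1
        \<comment> \<open>Both conjugated factors lie in row \<open>s\<close>, so row
          \<open>s'\<close> holds one or two plain factors and no conjugated one; such a moment is
          0.\<close>
        have "prod ?f {..<n} = 0" using 1 True 4 mom mom' lt
          by (intro z[of s']) (auto simp: numeral_2_eq_2)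
        thus ?thesis using 1 True 4 by auto
      next
        case 2
        have "prod ?f {..<n} = 0" using 2 True 4 mom mom' lt
          by (intro z[of t']) (auto simp: numeral_2_eq_2)
        thus ?thesis using 2 True 4 by auto
      next
        case 3
        \<comment> \<open>All four factors share a cell. The three conditions on the right hold
          simultaneously and contribute 1 + B + 1.\<close>
        have "prod ?f {..<n} = (\<Prod>i<n. if i = s then 2 + B else 1)"
          using 3 True 4 mom by (intro prod.cong refl) (auto simp: numeral_2_eq_2)
        also have "\<dots> = 2 + B" using lt by simp
        finally show ?thesis using 3 True 4 by simp
      qed
    next
      case False
      consider "s \<noteq> s'" "s \<noteq> t'" | "t \<noteq> s'" "t \<noteq> t'" | "s' = s" "t' = t" | "s' = t" "t' = s"
        using False by blast
      thus ?thesis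
      proof cases
        case 1
        have "prod ?f {..<n} = 0" using 1 False 4 mom mom' lt by (intro z[of s]) auto
        thus ?thesis using 1 False 4 by auto
      next
        case 2
        have "prod ?f {..<n} = 0" using 2 False 4 mom mom' lt by (intro z[of t]) auto
        thus ?thesis using 2 False 4 by auto
      next
        case 3
        have "prod ?f {..<n} = 1" using 3 False 4 mom mom' lt by (intro o) auto
        thus ?thesis using 3 False 4 by auto
      next
        case 4
        have "prod ?f {..<n} = 1" using 4 False \<open>P\<close> \<open>Q\<close> mom mom' lt by (intro o) auto
        thus ?thesis using 4 False \<open>P\<close> \<open>Q\<close> by auto
      qed
    qed
  qed
qed

text \<open>\<open>A\<close> holds the columns paired across the determinants, \<open>D\<close>
  those carrying the cumulant; the rest is paired within each determinant. Outside \<open>A\<close>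
  injectivity turns \<open>\<sigma> j = \<sigma> (\<pi> j)\<close> into a fixed point of \<pi>, and
  likewise for \<rho>; on \<open>A\<close> the two relations determine \<rho> from \<pi>.\<close>

lemma swap_pairing_iff:
  assumes inj: "inj_on \<sigma> S" "inj_on \<tau> T" and pr: "\<pi> permutes S" "\<rho> permutes T"
    and AD: "A \<union> D \<subseteq> S \<inter> T" "A \<inter> D = {}"
  shows "(\<forall>j\<in>A. \<sigma> j = \<tau> (\<rho> j) \<and> \<tau> j = \<sigma> (\<pi> j)) \<and>
         (\<forall>j\<in>D. \<sigma> j = \<tau> j \<and> \<sigma> j = \<sigma> (\<pi> j) \<and> \<tau> j = \<tau> (\<rho> j)) \<and>
         (\<forall>j\<in>S \<union> T - A - D. (j \<in> S \<longrightarrow> \<sigma> j = \<sigma> (\<pi> j)) \<and> (j \<in> T \<longrightarrow> \<tau> j = \<tau> (\<rho> j))) \<longleftrightarrow>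
       (\<forall>j\<in>D. \<sigma> j = \<tau> j) \<and> \<pi> permutes A \<and> (\<forall>j\<in>A. \<tau> j = \<sigma> (\<pi> j)) \<and> \<rho> = inv_into UNIV \<pi>"
    (is "?L \<longleftrightarrow> ?R")
proof
  assume L: ?L
  have fix1: "\<pi> j = j" if "j \<in> S - A" for j
  proof -
    have "\<sigma> (\<pi> j) = \<sigma> j" using L that by (cases "j \<in> D") auto
    thus ?thesis using inj(1) that permutes_in_image[OF pr(1), of j] by (auto dest: inj_onD)
  qed
  have fix2: "\<rho> j = j" if "j \<in> T - A" for j
  proof -
    have "\<tau> (\<rho> j) = \<tau> j" using L that by (cases "j \<in> D") auto
    thus ?thesis using inj(2) that permutes_in_image[OF pr(2), of j] by (auto dest: inj_onD)
  qed
  have p: "\<pi> permutes A" using permutes_superset[OF pr(1)] fix1 by auto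
  have r: "\<rho> permutes A" using permutes_superset[OF pr(2)] fix2 by auto
  have "\<rho> = inv_into UNIV \<pi>"
  proof
    fix j
    show "\<rho> j = inv_into UNIV \<pi> j"
    proof (cases "j \<in> A")
      case True
      \<comment> \<open>With \<open>k\<close> the preimage of \<open>j\<close> under \<pi>,
        \<open>\<tau> (\<rho> j) = \<sigma> j = \<sigma> (\<pi> k) = \<tau> k\<close>, and \<tau> is
        injective.\<close>
      define k where "k = inv_into UNIV \<pi> j"
      have k: "k \<in> A" "\<pi> k = j"
        using True permutes_in_image[OF permutes_inv[OF p], of j] permutes_inverses[OF p]
        by (auto simp: k_def)
      have "\<tau> (\<rho> j) = \<tau> k" using L True k by auto
      thus ?thesis using inj(2) True k AD permutes_in_image[OF r, of j]
        by (metis IntD2 UnCI inj_onD k_def subsetD)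
    next
      case False
      thus ?thesis using r permutes_inv[OF p] by (auto simp: permutes_def)
    qed
  qed
  thus ?R using L p by blast
next
  assume R: ?R
  hence p: "\<pi> permutes A" and r: "\<rho> = inv_into UNIV \<pi>" by auto
  have r': "\<rho> permutes A" using permutes_inv[OF p] r by simp
  have "\<sigma> j = \<tau> (\<rho> j)" if "j \<in> A" for j
  proof -
    have "\<rho> j \<in> A" using that permutes_in_image[OF r'] by blast
    hence "\<tau> (\<rho> j) = \<sigma> (\<pi> (\<rho> j))" using R by blast
    thus ?thesis using permutes_inverses[OF p] r by simp
  qed
  moreover have "\<pi> j = j" "\<rho> j = j" if "j \<notin> A" for j
    using that p r' by (auto simp: permutes_def)
  moreover have "j \<notin> A" if "j \<in> D" for j
    using that AD by auto
  moreover have "\<forall>j\<in>D. \<sigma> j = \<tau> j" "\<forall>j\<in>A. \<tau> j = \<sigma> (\<pi> j)"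
    using R by blast+
  ultimately show ?L by simp
qed

text \<open>Multiplying out the three-term factors assigns every column to a set \<open>A\<close>, a
  set \<open>D\<close> or the rest. For fixed \<open>A\<close> and \<open>D\<close> only pairs with
  \<rho> inverse to \<pi> survive, so the double sum over permutations collapses to a count.\<close>

lemma sum_permutes_wick:
  fixes \<sigma> \<tau> :: "nat \<Rightarrow> nat" and B :: complex
  assumes U: "finite U" and S: "S \<subseteq> U" and T: "T \<subseteq> U" and inj: "inj_on \<sigma> S" "inj_on \<tau> T"
  shows "(\<Sum>\<pi> | \<pi> permutes S. \<Sum>\<rho> | \<rho> permutes T. of_int (sign \<pi>) * of_int (sign \<rho>) *
     (\<Prod>j\<in>U. of_bool (j \<in> S \<and> j \<in> T \<and> \<sigma> j = \<tau> (\<rho> j) \<and> \<tau> j = \<sigma> (\<pi> j)) +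
        (B * of_bool (j \<in> S \<and> j \<in> T \<and> \<sigma> j = \<tau> j \<and> \<sigma> j = \<sigma> (\<pi> j) \<and> \<tau> j = \<tau> (\<rho> j)) +
         of_bool ((j \<in> S \<longrightarrow> \<sigma> j = \<sigma> (\<pi> j)) \<and> (j \<in> T \<longrightarrow> \<tau> j = \<tau> (\<rho> j)))))) =
   (\<Sum>A\<in>Pow U. \<Sum>D\<in>Pow (U - A). of_bool (A \<union> D \<subseteq> S \<inter> T \<and> (\<forall>j\<in>D. \<sigma> j = \<tau> j)) * B ^ card D *
      of_nat (card {\<pi>. \<pi> permutes A \<and> (\<forall>j\<in>A. \<tau> j = \<sigma> (\<pi> j))}))"
proof -
  have fin: "finite S" "finite T" using S T U by (auto intro: finite_subset)
  define v where "v \<pi> \<rho> j = (of_bool (j \<in> S \<and> j \<in> T \<and> \<sigma> j = \<tau> (\<rho> j) \<and> \<tau> j = \<sigma> (\<pi> j)) :: complex)" for \<pi> \<rho> j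
  define w where "w \<pi> \<rho> j = B * of_bool (j \<in> S \<and> j \<in> T \<and> \<sigma> j = \<tau> j \<and> \<sigma> j = \<sigma> (\<pi> j) \<and> \<tau> j = \<tau> (\<rho> j))" for \<pi> \<rho> j
  define u where "u \<pi> \<rho> j = (of_bool ((j \<in> S \<longrightarrow> \<sigma> j = \<sigma> (\<pi> j)) \<and> (j \<in> T \<longrightarrow> \<tau> j = \<tau> (\<rho> j))) :: complex)" for \<pi> \<rho> j
  define sg where "sg \<pi> \<rho> = (of_int (sign \<pi>) * of_int (sign \<rho>) :: complex)" for \<pi> \<rho> :: "nat \<Rightarrow> nat"
  define G where "G \<pi> \<rho> A D = (\<Prod>j\<in>A. v \<pi> \<rho> j) * ((\<Prod>j\<in>D. w \<pi> \<rho> j) * (\<Prod>j\<in>U - A - D. u \<pi> \<rho> j))" for \<pi> \<rho> A D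
  let ?PS = "{\<pi>. \<pi> permutes S}" and ?PT = "{\<rho>. \<rho> permutes T}"
  have expand: "(\<Prod>j\<in>U. v \<pi> \<rho> j + (w \<pi> \<rho> j + u \<pi> \<rho> j)) = (\<Sum>A\<in>Pow U. \<Sum>D\<in>Pow (U - A). G \<pi> \<rho> A D)" for \<pi> \<rho>
    using U by (simp add: prod_add G_def sum_distrib_left)
  have main: "(\<Sum>\<pi>\<in>?PS. \<Sum>\<rho>\<in>?PT. sg \<pi> \<rho> * G \<pi> \<rho> A D) =
      of_bool (A \<union> D \<subseteq> S \<inter> T \<and> (\<forall>j\<in>D. \<sigma> j = \<tau> j)) * B ^ card D *
      of_nat (card {\<pi>. \<pi> permutes A \<and> (\<forall>j\<in>A. \<tau> j = \<sigma> (\<pi> j))})"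
    if A: "A \<in> Pow U" and D: "D \<in> Pow (U - A)" for A D
  proof -
    have fA: "finite A" "finite D" using A D U by (auto intro: finite_subset)
    show ?thesis
    proof (cases "A \<union> D \<subseteq> S \<inter> T")
      case False
      have "G \<pi> \<rho> A D = 0" for \<pi> \<rho>
      proof -
        from False consider j where "j \<in> A" "j \<notin> S \<inter> T" | j where "j \<in> D" "j \<notin> S \<inter> T" by blast
        thus ?thesis
        proof cases
          case 1
          hence "(\<Prod>j\<in>A. v \<pi> \<rho> j) = 0" using fA by (intro prod_zero) (auto simp: v_def)
          thus ?thesis by (simp add: G_def)
        next
          case 2
          hence "(\<Prod>j\<in>D. w \<pi> \<rho> j) = 0" using fA by (intro prod_zero) (auto simp: w_def)
          thus ?thesis by (simp add: G_def)
        qed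
      qed
      moreover have "of_bool (A \<union> D \<subseteq> S \<inter> T \<and> (\<forall>j\<in>D. \<sigma> j = \<tau> j)) = (0 :: complex)"
        using False by (subst of_bool_eq_0_iff) blast
      ultimately show ?thesis by (simp only: mult_zero_left mult_zero_right sum.neutral_const)
    next
      case True
      define Q where "Q = {\<pi>. \<pi> permutes A \<and> (\<forall>j\<in>A. \<tau> j = \<sigma> (\<pi> j))}"
      define c where "c = of_bool (\<forall>j\<in>D. \<sigma> j = \<tau> j) * B ^ card D"
      have disj: "A \<inter> D = {}" using D by auto
      have G: "sg \<pi> \<rho> * G \<pi> \<rho> A D = (if \<rho> = inv_into UNIV \<pi> then (if \<pi> \<in> Q then c else 0) else 0)"
        if p: "\<pi> \<in> ?PS" "\<rho> \<in> ?PT" for \<pi> \<rho>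
      proof -
        have "(\<Prod>j\<in>A. v \<pi> \<rho> j) = of_bool (\<forall>j\<in>A. \<sigma> j = \<tau> (\<rho> j) \<and> \<tau> j = \<sigma> (\<pi> j))"
          unfolding v_def prod_of_bool[OF fA(1)] using True by (intro arg_cong[where f = of_bool]) auto
        moreover have "(\<Prod>j\<in>D. w \<pi> \<rho> j) = B ^ card D *
            of_bool (\<forall>j\<in>D. \<sigma> j = \<tau> j \<and> \<sigma> j = \<sigma> (\<pi> j) \<and> \<tau> j = \<tau> (\<rho> j))"
          unfolding w_def prod.distrib prod_of_bool[OF fA(2)] prod_constant
          using True by (intro arg_cong2[where f = "(*)"] arg_cong[where f = of_bool]) auto
        moreover have "(\<Prod>j\<in>U - A - D. u \<pi> \<rho> j) =
           of_bool (\<forall>j\<in>S \<union> T - A - D. (j \<in> S \<longrightarrow> \<sigma> j = \<sigma> (\<pi> j)) \<and> (j \<in> T \<longrightarrow> \<tau> j = \<tau> (\<rho> j)))"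
          unfolding u_def using S T U
          by (subst prod_of_bool) (auto intro!: arg_cong[where f = of_bool])
        ultimately have "G \<pi> \<rho> A D = B ^ card D * of_bool (
           (\<forall>j\<in>A. \<sigma> j = \<tau> (\<rho> j) \<and> \<tau> j = \<sigma> (\<pi> j)) \<and>
           (\<forall>j\<in>D. \<sigma> j = \<tau> j \<and> \<sigma> j = \<sigma> (\<pi> j) \<and> \<tau> j = \<tau> (\<rho> j)) \<and>
           (\<forall>j\<in>S \<union> T - A - D. (j \<in> S \<longrightarrow> \<sigma> j = \<sigma> (\<pi> j)) \<and> (j \<in> T \<longrightarrow> \<tau> j = \<tau> (\<rho> j))))"
          by (simp add: G_def of_bool_conj)
        also have "\<dots> = B ^ card D * of_bool ((\<forall>j\<in>D. \<sigma> j = \<tau> j) \<and> \<pi> permutes A \<and>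
             (\<forall>j\<in>A. \<tau> j = \<sigma> (\<pi> j)) \<and> \<rho> = inv_into UNIV \<pi>)"
          using swap_pairing_iff[OF inj, of \<pi> \<rho> A D] p True disj by simp
        finally have G': "G \<pi> \<rho> A D = (if \<rho> = inv_into UNIV \<pi> then (if \<pi> \<in> Q then c else 0) else 0)"
          by (auto simp: Q_def c_def)
        have "sg \<pi> (inv_into UNIV \<pi>) = 1"
        proof -
          have "permutation \<pi>" using p fin by (auto simp: permutation_permutes)
          thus ?thesis using sign_inverse[of \<pi>] by (simp add: sg_def flip: of_int_mult)
        qed
        thus ?thesis unfolding G' by auto
      qed
      have "(\<Sum>\<pi>\<in>?PS. \<Sum>\<rho>\<in>?PT. sg \<pi> \<rho> * G \<pi> \<rho> A D) =
          (\<Sum>\<pi>\<in>?PS. \<Sum>\<rho>\<in>?PT. if \<rho> = inv_into UNIV \<pi> then (if \<pi> \<in> Q then c else 0) else 0)"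
        by (intro sum.cong refl G)
      also have "\<dots> = (\<Sum>\<pi>\<in>?PS. if \<pi> \<in> Q then c else 0)"
      proof (intro sum.cong refl)
        fix \<pi> assume "\<pi> \<in> ?PS"
        have "inv_into UNIV \<pi> \<in> ?PT" if "\<pi> \<in> Q"
          using that True permutes_inv[of \<pi> A] by (auto simp: Q_def intro: permutes_subset)
        thus "(\<Sum>\<rho>\<in>?PT. if \<rho> = inv_into UNIV \<pi> then (if \<pi> \<in> Q then c else 0) else 0) = (if \<pi> \<in> Q then c else 0)"
          using fin by (subst sum.delta) (auto simp: finite_permutations)
      qed
      also have "\<dots> = (\<Sum>\<pi>\<in>Q. c)"
      proof -
        have "Q \<subseteq> ?PS" using True by (auto simp: Q_def intro: permutes_subset)
        thus ?thesis using fin by (simp add: sum.If_cases finite_permutations Int_absorb1)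
      qed
      finally show ?thesis using True by (simp add: c_def Q_def)
    qed
  qed
  have "(\<Sum>\<pi>\<in>?PS. \<Sum>\<rho>\<in>?PT. sg \<pi> \<rho> * (\<Prod>j\<in>U. v \<pi> \<rho> j + (w \<pi> \<rho> j + u \<pi> \<rho> j))) =
     (\<Sum>\<pi>\<in>?PS. \<Sum>\<rho>\<in>?PT. \<Sum>A\<in>Pow U. \<Sum>D\<in>Pow (U - A). sg \<pi> \<rho> * G \<pi> \<rho> A D)"
    by (simp add: expand sum_distrib_left)
  also have "\<dots> = (\<Sum>\<pi>\<in>?PS. \<Sum>A\<in>Pow U. \<Sum>\<rho>\<in>?PT. \<Sum>D\<in>Pow (U - A). sg \<pi> \<rho> * G \<pi> \<rho> A D)"
    by (rule sum.cong[OF refl], rule sum.swap)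
  also have "\<dots> = (\<Sum>A\<in>Pow U. \<Sum>\<pi>\<in>?PS. \<Sum>\<rho>\<in>?PT. \<Sum>D\<in>Pow (U - A). sg \<pi> \<rho> * G \<pi> \<rho> A D)"
    by (rule sum.swap)
  also have "\<dots> = (\<Sum>A\<in>Pow U. \<Sum>\<pi>\<in>?PS. \<Sum>D\<in>Pow (U - A). \<Sum>\<rho>\<in>?PT. sg \<pi> \<rho> * G \<pi> \<rho> A D)"
    by (rule sum.cong[OF refl], rule sum.cong[OF refl], rule sum.swap)
  also have "\<dots> = (\<Sum>A\<in>Pow U. \<Sum>D\<in>Pow (U - A). \<Sum>\<pi>\<in>?PS. \<Sum>\<rho>\<in>?PT. sg \<pi> \<rho> * G \<pi> \<rho> A D)"
    by (rule sum.cong[OF refl], rule sum.swap)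
  also have "\<dots> = (\<Sum>A\<in>Pow U. \<Sum>D\<in>Pow (U - A). of_bool (A \<union> D \<subseteq> S \<inter> T \<and> (\<forall>j\<in>D. \<sigma> j = \<tau> j)) * B ^ card D *
      of_nat (card {\<pi>. \<pi> permutes A \<and> (\<forall>j\<in>A. \<tau> j = \<sigma> (\<pi> j))}))"
    by (rule sum.cong[OF refl], rule sum.cong[OF refl], rule main)
  finally show ?thesis unfolding v_def w_def u_def sg_def .
qed

subsection \<open>Counting injections\<close>

lemma finite_inj_maps: "finite S \<Longrightarrow> finite T \<Longrightarrow> finite (inj_maps S T)"
  by (rule finite_subset[of _ "S \<rightarrow>\<^sub>E T"]) (auto simp: inj_maps_def intro: finite_PiE)

lemma card_inj_maps:
  assumes "finite S" "finite T" "card S \<le> card T"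
  shows "(of_nat (card (inj_maps S T)) :: 'a :: field_char_0) = fact (card T) / fact (card T - card S)"
proof -
  have "(\<Prod>i<k. n - i) * fact (n - k) = (fact n :: nat)" if "k \<le> n" for n k :: nat
    using that
  proof (induction k)
    case (Suc k)
    hence "fact (n - k) = (n - k) * (fact (n - Suc k) :: nat)"
      using fact_Suc[of "n - Suc k", where 'a = nat] by (simp add: Suc_diff_Suc)
    hence "(\<Prod>i<Suc k. n - i) * fact (n - Suc k) = (\<Prod>i<k. n - i) * fact (n - k)" by simp
    thus ?case using Suc by simp
  qed simp
  moreover have "card (inj_maps S T) = (\<Prod>i<card S. card T - i)"
    unfolding inj_maps_def using card_inj_on_subset_funcset[of S T S] assms
    by (simp add: atLeast0LessThan)
  ultimately have "card (inj_maps S T) * fact (card T - card S) = (fact (card T) :: nat)"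
    using assms by simp
  from arg_cong[OF this, of "of_nat :: nat \<Rightarrow> 'a"]
  have "(of_nat (card (inj_maps S T)) :: 'a) * fact (card T - card S) = fact (card T)"
    by simp
  thus ?thesis by (simp add: field_simps)
qed

text \<open>Restriction to \<open>S - V\<close> is a bijection onto the injections into the values
  not taken by \<open>g\<close>. The count is the same for every admissible \<open>g\<close>, which
  later removes the dependence on \<sigma> and \<pi>.\<close>

lemma card_inj_maps_extending:
  assumes fin: "finite S" "finite T" and V: "V \<subseteq> S" and g: "g ` V \<subseteq> T" "inj_on g V"
    and le: "card S \<le> card T"
  shows "(of_nat (card {\<tau> \<in> inj_maps S T. \<forall>j\<in>V. \<tau> j = g j}) :: 'a :: field_char_0) =
     fact (card T - card V) / fact (card T - card S)"
proof -
  have "bij_betw (\<lambda>\<tau>. restrict \<tau> (S - V)) {\<tau> \<in> inj_maps S T. \<forall>j\<in>V. \<tau> j = g j} (inj_maps (S - V) (T - g ` V))"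
  proof (rule bij_betw_byWitness[where f' = "\<lambda>h j. if j \<in> V then g j else h j"])
    show "\<forall>\<tau>\<in>{\<tau> \<in> inj_maps S T. \<forall>j\<in>V. \<tau> j = g j}. (\<lambda>j. if j \<in> V then g j else restrict \<tau> (S - V) j) = \<tau>"
      by (auto simp: inj_maps_def fun_eq_iff PiE_def extensional_def)
    show "\<forall>h\<in>inj_maps (S - V) (T - g ` V). restrict (\<lambda>j. if j \<in> V then g j else h j) (S - V) = h"
      by (auto simp: inj_maps_def fun_eq_iff PiE_def extensional_def)
    show "(\<lambda>\<tau>. restrict \<tau> (S - V)) ` {\<tau> \<in> inj_maps S T. \<forall>j\<in>V. \<tau> j = g j} \<subseteq> inj_maps (S - V) (T - g ` V)"
    proof safe
      fix \<tau> assume t: "\<tau> \<in> inj_maps S T" "\<forall>j\<in>V. \<tau> j = g j"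
      have "\<tau> i \<noteq> g j" if "i \<in> S - V" "j \<in> V" for i j
      proof
        assume "\<tau> i = g j"
        hence "\<tau> i = \<tau> j" using t that by simp
        moreover have "inj_on \<tau> S" "i \<in> S" "j \<in> S" using t that V by (auto simp: inj_maps_def)
        ultimately have "i = j" by (meson inj_onD)
        thus False using that by simp
      qed
      thus "restrict \<tau> (S - V) \<in> inj_maps (S - V) (T - g ` V)"
        using t by (auto simp: inj_maps_def inj_on_def)
    qed
    show "(\<lambda>h j. if j \<in> V then g j else h j) ` inj_maps (S - V) (T - g ` V) \<subseteq> {\<tau> \<in> inj_maps S T. \<forall>j\<in>V. \<tau> j = g j}"
    proof safe
      fix h assume h: "h \<in> inj_maps (S - V) (T - g ` V)"
      let ?k = "\<lambda>j. if j \<in> V then g j else h j"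
      have "?k \<in> S \<rightarrow>\<^sub>E T"
      proof
        fix x assume "x \<in> S"
        thus "?k x \<in> T" using h g V by (auto simp: inj_maps_def PiE_def)
      next
        fix x assume "x \<notin> S"
        thus "?k x = undefined" using h V by (auto simp: inj_maps_def PiE_def extensional_def)
      qed
      moreover have "inj_on ?k (V \<union> (S - V))"
        unfolding inj_on_Un
      proof (intro conjI)
        show "inj_on ?k V" using g by (auto simp: inj_on_def)
        show "inj_on ?k (S - V)" using h by (auto simp: inj_maps_def inj_on_def)
        show "?k ` (V - (S - V)) \<inter> ?k ` (S - V - V) = {}"
        proof -
          have "h j \<notin> g ` V" if "j \<in> S - V" for j
            using h that by (auto simp: inj_maps_def PiE_def)
          hence "?k ` (S - V - V) \<subseteq> - (g ` V)" by auto
          moreover have "?k ` (V - (S - V)) \<subseteq> g ` V" by auto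
          ultimately show ?thesis by blast
        qed
      qed
      ultimately show "?k \<in> inj_maps S T" using V by (simp add: inj_maps_def Un_absorb1)
    qed auto
  qed
  hence "card {\<tau> \<in> inj_maps S T. \<forall>j\<in>V. \<tau> j = g j} = card (inj_maps (S - V) (T - g ` V))"
    by (rule bij_betw_same_card)
  moreover have fV: "finite V" using V fin finite_subset by blast
  moreover have c: "card (S - V) = card S - card V" "card (T - g ` V) = card T - card V"
    using fV V g by (simp_all add: card_Diff_subset card_image)
  moreover have "card V \<le> card S" using V fin card_mono by blast
  ultimately show ?thesis using card_inj_maps[of "S - V" "T - g ` V", where 'a = 'a] fin le
    by (simp add: diff_le_mono)
qed

section \<open>Sums over sets of columns\<close>

lemma sum_Pow_card:
  fixes f :: "nat \<Rightarrow> 'a :: comm_semiring_1"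
  assumes "finite U"
  shows "(\<Sum>S\<in>Pow U. f (card S)) = (\<Sum>k\<le>card U. of_nat (card U choose k) * f k)"
proof -
  have "(\<Sum>S\<in>Pow U. f (card S)) = (\<Sum>k\<le>card U. \<Sum>S\<in>{S \<in> Pow U. card S = k}. f (card S))"
    using assms by (intro sum.group[symmetric]) (auto simp: card_mono)
  also have "\<dots> = (\<Sum>k\<le>card U. of_nat (card U choose k) * f k)"
  proof (intro sum.cong refl)
    fix k
    have "(\<Sum>S\<in>{S \<in> Pow U. card S = k}. f (card S)) = (\<Sum>S\<in>{S \<in> Pow U. card S = k}. f k)"
      by (intro sum.cong) auto
    thus "(\<Sum>S\<in>{S \<in> Pow U. card S = k}. f (card S)) = of_nat (card U choose k) * f k"
      using n_subsets[OF assms, of k] by simp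
  qed
  finally show ?thesis .
qed

text \<open>Complementation turns supersets of \<open>V\<close> into subsets of
  \<open>U - V\<close>, and \<open>card U - card S\<close>, the exponent of the spectral variable,
  into their cardinality.\<close>

lemma sum_supersets_card:
  fixes f :: "nat \<Rightarrow> 'a :: comm_semiring_1"
  assumes U: "finite U" and V: "V \<subseteq> U"
  shows "(\<Sum>S\<in>Pow U. of_bool (V \<subseteq> S) * f (card U - card S)) =
    (\<Sum>k\<le>card U - card V. of_nat ((card U - card V) choose k) * f k)"
proof -
  have "(\<Sum>S\<in>Pow U. of_bool (V \<subseteq> S) * f (card U - card S)) =
     (\<Sum>S | S \<subseteq> U \<and> V \<subseteq> S. f (card U - card S))"
    using U by (intro sum.mono_neutral_cong_right) auto
  also have "\<dots> = (\<Sum>W\<in>Pow (U - V). f (card W))"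
  proof (rule sum.reindex_bij_witness[of _ "\<lambda>W. U - W" "\<lambda>S. U - S"])
    fix S assume "S \<in> {S. S \<subseteq> U \<and> V \<subseteq> S}"
    thus "f (card (U - S)) = f (card U - card S)"
      using U by (auto simp: card_Diff_subset finite_subset)
  qed (use V in auto)
  also have "\<dots> = (\<Sum>k\<le>card U - card V. of_nat ((card U - card V) choose k) * f k)"
    using sum_Pow_card[of "U - V" f] U V by (simp add: card_Diff_subset finite_subset)
  finally show ?thesis .
qed

text \<open>Interchanging the sums makes \<pi> the outer variable. As \<pi> fixes \<open>D\<close>
  pointwise, both conditions together say that \<tau> agrees on \<open>A \<union> D\<close> with
  \<sigma> composed with \<pi>, so every permutation of \<open>A\<close> leaves the same number of
  extensions.\<close>

lemma sum_inj_maps_wick: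
  assumes fin: "finite S" "finite T" "finite R" and AD: "A \<union> D \<subseteq> S \<inter> T" "A \<inter> D = {}"
    and \<sigma>: "\<sigma> \<in> inj_maps S R" and le: "card T \<le> card R"
  shows "(\<Sum>\<tau>\<in>inj_maps T R. of_bool (\<forall>j\<in>D. \<sigma> j = \<tau> j) *
       of_nat (card {\<pi>. \<pi> permutes A \<and> (\<forall>j\<in>A. \<tau> j = \<sigma> (\<pi> j))})) =
     (fact (card A) * fact (card R - card A - card D) / fact (card R - card T) :: 'a :: field_char_0)"
proof -
  have fA: "finite A" "finite D" using AD fin by (auto intro: finite_subset)
  let ?P = "{\<pi>. \<pi> permutes A}"
  have fP: "finite ?P" using fA by (simp add: finite_permutations)
  have "(\<Sum>\<tau>\<in>inj_maps T R. of_bool (\<forall>j\<in>D. \<sigma> j = \<tau> j) *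
       of_nat (card {\<pi>. \<pi> permutes A \<and> (\<forall>j\<in>A. \<tau> j = \<sigma> (\<pi> j))})) =
     (\<Sum>\<tau>\<in>inj_maps T R. \<Sum>\<pi>\<in>?P. of_bool (\<forall>j\<in>A \<union> D. \<tau> j = \<sigma> (\<pi> j)) :: 'a)"
  proof (intro sum.cong refl)
    fix \<tau>
    have "(\<Sum>\<pi>\<in>?P. of_bool (\<forall>j\<in>A \<union> D. \<tau> j = \<sigma> (\<pi> j)) :: 'a) =
       (\<Sum>\<pi>\<in>?P. of_bool (\<forall>j\<in>D. \<sigma> j = \<tau> j) * of_bool (\<forall>j\<in>A. \<tau> j = \<sigma> (\<pi> j)))"
    proof (intro sum.cong refl)
      fix \<pi> assume "\<pi> \<in> ?P"
      hence "\<pi> j = j" if "j \<in> D" for j using that AD by (auto simp: permutes_def)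
      thus "(of_bool (\<forall>j\<in>A \<union> D. \<tau> j = \<sigma> (\<pi> j)) :: 'a) =
        of_bool (\<forall>j\<in>D. \<sigma> j = \<tau> j) * of_bool (\<forall>j\<in>A. \<tau> j = \<sigma> (\<pi> j))"
        unfolding of_bool_conj[symmetric] by (intro arg_cong[where f = of_bool]) (auto simp: ball_Un)
    qed
    also have "\<dots> = of_bool (\<forall>j\<in>D. \<sigma> j = \<tau> j) * (\<Sum>\<pi>\<in>?P. of_bool (\<forall>j\<in>A. \<tau> j = \<sigma> (\<pi> j)))"
      by (rule sum_distrib_left[symmetric])
    also have "(\<Sum>\<pi>\<in>?P. of_bool (\<forall>j\<in>A. \<tau> j = \<sigma> (\<pi> j)) :: 'a) =
        of_nat (card {\<pi>. \<pi> permutes A \<and> (\<forall>j\<in>A. \<tau> j = \<sigma> (\<pi> j))})"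
      using fP by (simp add: sum_of_bool_eq Collect_conj_eq)
    finally show "of_bool (\<forall>j\<in>D. \<sigma> j = \<tau> j) *
       of_nat (card {\<pi>. \<pi> permutes A \<and> (\<forall>j\<in>A. \<tau> j = \<sigma> (\<pi> j))}) =
      (\<Sum>\<pi>\<in>?P. of_bool (\<forall>j\<in>A \<union> D. \<tau> j = \<sigma> (\<pi> j)) :: 'a)" by simp
  qed
  also have "\<dots> = (\<Sum>\<pi>\<in>?P. \<Sum>\<tau>\<in>inj_maps T R. of_bool (\<forall>j\<in>A \<union> D. \<tau> j = \<sigma> (\<pi> j)))"
    by (rule sum.swap)
  also have "\<dots> = (\<Sum>\<pi>\<in>?P. fact (card R - card A - card D) / fact (card R - card T))"
  proof (intro sum.cong refl)
    fix \<pi> assume "\<pi> \<in> ?P"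
    hence p: "\<pi> permutes A" by simp
    have fixD: "\<pi> j = j" if "j \<in> D" for j using that AD p by (auto simp: permutes_def)
    have pAD: "\<pi> permutes (A \<union> D)" using p by (rule permutes_subset) auto
    have inS: "\<pi> j \<in> S" if "j \<in> A \<union> D" for j
      using that AD permutes_in_image[OF pAD, of j] by auto
    have "(\<Sum>\<tau>\<in>inj_maps T R. of_bool (\<forall>j\<in>A \<union> D. \<tau> j = \<sigma> (\<pi> j)) :: 'a) =
      of_nat (card {\<tau> \<in> inj_maps T R. \<forall>j\<in>A \<union> D. \<tau> j = \<sigma> (\<pi> j)})"
      using finite_inj_maps[OF fin(2,3)] by (simp add: Int_def)
    also have "\<dots> = fact (card R - card (A \<union> D)) / fact (card R - card T)"
    proof (rule card_inj_maps_extending)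
      show "(\<lambda>j. \<sigma> (\<pi> j)) ` (A \<union> D) \<subseteq> R" using inS \<sigma> by (fastforce simp: inj_maps_def PiE_def)
      show "inj_on (\<lambda>j. \<sigma> (\<pi> j)) (A \<union> D)"
        using \<sigma> inS permutes_inj[OF p] unfolding inj_maps_def inj_on_def by blast
    qed (use fin AD le in auto)
    also have "card R - card (A \<union> D) = card R - card A - card D"
      using AD fA by (simp add: card_Un_disjoint)
    finally show "(\<Sum>\<tau>\<in>inj_maps T R. of_bool (\<forall>j\<in>A \<union> D. \<tau> j = \<sigma> (\<pi> j)) :: 'a) =
      fact (card R - card A - card D) / fact (card R - card T)" .
  qed
  also have "\<dots> = fact (card A) * fact (card R - card A - card D) / fact (card R - card T)"
    using card_permutations[OF refl fA(1)] by simp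
  finally show ?thesis .
qed

text \<open>Once \<tau> is summed out nothing depends on \<sigma>, and what remains separates into a
  factor for \<open>S\<close> and one for \<open>T\<close> that see only the cardinalities of
  \<open>A\<close> and \<open>D\<close>. Choosing these sets and permuting \<open>A\<close> gives
  the weight (m choose a) a! (m - a choose d) = m! / (d! (m - a - d)!).\<close>

lemma sum_wick_total:
  fixes x y B :: "'a :: field_char_0"
  assumes mn: "m \<le> n"
  shows "(\<Sum>S\<in>Pow {..<m}. \<Sum>T\<in>Pow {..<m}. x ^ (m - card S) * y ^ (m - card T) *
      (\<Sum>\<sigma>\<in>inj_maps S {..<n}. \<Sum>\<tau>\<in>inj_maps T {..<n}. \<Sum>A\<in>Pow {..<m}. \<Sum>D\<in>Pow ({..<m} - A).
        of_bool (A \<union> D \<subseteq> S \<inter> T \<and> (\<forall>j\<in>D. \<sigma> j = \<tau> j)) * B ^ card D *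
        of_nat (card {\<pi>. \<pi> permutes A \<and> (\<forall>j\<in>A. \<tau> j = \<sigma> (\<pi> j))}))) =
     fact n * fact m * (\<Sum>a\<le>m. \<Sum>d\<le>m - a. B ^ d / fact d * (fact (n - a - d) / fact (m - a - d)) *
        (\<Sum>p\<le>m - a - d. of_nat ((m - a - d) choose p) * (x ^ p / fact (n - m + p))) *
        (\<Sum>q\<le>m - a - d. of_nat ((m - a - d) choose q) * (y ^ q / fact (n - m + q))))"
proof -
  let ?U = "{..<m}"
  define N where "N = {..<n}"
  define Cx where "Cx \<sigma> \<tau> A D = (of_bool (\<forall>j\<in>D. \<sigma> j = \<tau> j) *
       of_nat (card {\<pi>. \<pi> permutes A \<and> (\<forall>j\<in>A. \<tau> j = \<sigma> (\<pi> j))}) :: 'a)" for \<sigma> \<tau> :: "nat \<Rightarrow> nat" and A D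
  define g where "g z S = z ^ (m - card S) / (fact (n - card S) :: 'a)" for z :: 'a and S :: "nat set"
  define h where "h A D z = (\<Sum>S\<in>Pow ?U. of_bool (A \<union> D \<subseteq> S) * g z S)" for A D :: "nat set" and z :: 'a
  have fN: "finite N" "card N = n" by (auto simp: N_def)
  have cS: "card S \<le> n" "finite S" if "S \<in> Pow ?U" for S
    using that card_mono[of ?U S] mn by (auto intro: finite_subset)
  have hsum: "h A D z = (\<Sum>p\<le>m - card A - card D. of_nat ((m - card A - card D) choose p) * (z ^ p / fact (n - m + p)))"
    if "A \<in> Pow ?U" "D \<in> Pow (?U - A)" for A D z
  proof -
    have "card (A \<union> D) = card A + card D"
      using that by (intro card_Un_disjoint) (auto intro: finite_subset)
    moreover have "h A D z = (\<Sum>S\<in>Pow ?U. of_bool (A \<union> D \<subseteq> S) * (\<lambda>p. z ^ p / fact (n - m + p)) (card ?U - card S))"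
      unfolding h_def
    proof (intro sum.cong refl)
      fix S assume "S \<in> Pow ?U"
      hence "card S \<le> m" using card_mono[of ?U S] by auto
      \<comment> \<open>The constant offset \<open>n - m\<close> becomes the order \<alpha> of the
        Laguerre polynomials.\<close>
      hence "n - card S = n - m + (m - card S)" using mn by simp
      thus "of_bool (A \<union> D \<subseteq> S) * g z S =
        of_bool (A \<union> D \<subseteq> S) * (\<lambda>p. z ^ p / fact (n - m + p)) (card ?U - card S)"
        by (simp add: g_def)
    qed
    ultimately show ?thesis using that
      by (subst (asm) sum_supersets_card) auto
  qed
  have inner: "(\<Sum>\<sigma>\<in>inj_maps S N. \<Sum>\<tau>\<in>inj_maps T N. \<Sum>A\<in>Pow ?U. \<Sum>D\<in>Pow (?U - A).
        of_bool (A \<union> D \<subseteq> S \<inter> T \<and> (\<forall>j\<in>D. \<sigma> j = \<tau> j)) * B ^ card D *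
        of_nat (card {\<pi>. \<pi> permutes A \<and> (\<forall>j\<in>A. \<tau> j = \<sigma> (\<pi> j))})) =
     (\<Sum>A\<in>Pow ?U. \<Sum>D\<in>Pow (?U - A). of_bool (A \<union> D \<subseteq> S) * of_bool (A \<union> D \<subseteq> T) * B ^ card D *
        (fact n / fact (n - card S)) * (fact (card A) * fact (n - card A - card D) / fact (n - card T)))"
    if S: "S \<in> Pow ?U" and T: "T \<in> Pow ?U" for S T
  proof -
    have "(\<Sum>\<sigma>\<in>inj_maps S N. \<Sum>\<tau>\<in>inj_maps T N. \<Sum>A\<in>Pow ?U. \<Sum>D\<in>Pow (?U - A).
        of_bool (A \<union> D \<subseteq> S \<inter> T \<and> (\<forall>j\<in>D. \<sigma> j = \<tau> j)) * B ^ card D *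
        of_nat (card {\<pi>. \<pi> permutes A \<and> (\<forall>j\<in>A. \<tau> j = \<sigma> (\<pi> j))})) =
      (\<Sum>\<sigma>\<in>inj_maps S N. \<Sum>\<tau>\<in>inj_maps T N. \<Sum>A\<in>Pow ?U. \<Sum>D\<in>Pow (?U - A).
        of_bool (A \<union> D \<subseteq> S) * of_bool (A \<union> D \<subseteq> T) * B ^ card D * Cx \<sigma> \<tau> A D)"
      unfolding Cx_def by (intro sum.cong refl) (simp add: of_bool_conj mult_ac)
    also have "\<dots> = (\<Sum>\<sigma>\<in>inj_maps S N. \<Sum>A\<in>Pow ?U. \<Sum>\<tau>\<in>inj_maps T N. \<Sum>D\<in>Pow (?U - A).
        of_bool (A \<union> D \<subseteq> S) * of_bool (A \<union> D \<subseteq> T) * B ^ card D * Cx \<sigma> \<tau> A D)"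
      by (rule sum.cong[OF refl], rule sum.swap)
    also have "\<dots> = (\<Sum>A\<in>Pow ?U. \<Sum>\<sigma>\<in>inj_maps S N. \<Sum>\<tau>\<in>inj_maps T N. \<Sum>D\<in>Pow (?U - A).
        of_bool (A \<union> D \<subseteq> S) * of_bool (A \<union> D \<subseteq> T) * B ^ card D * Cx \<sigma> \<tau> A D)"
      by (rule sum.swap)
    also have "\<dots> = (\<Sum>A\<in>Pow ?U. \<Sum>\<sigma>\<in>inj_maps S N. \<Sum>D\<in>Pow (?U - A). \<Sum>\<tau>\<in>inj_maps T N.
        of_bool (A \<union> D \<subseteq> S) * of_bool (A \<union> D \<subseteq> T) * B ^ card D * Cx \<sigma> \<tau> A D)"
      by (rule sum.cong[OF refl], rule sum.cong[OF refl], rule sum.swap)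
    also have "\<dots> = (\<Sum>A\<in>Pow ?U. \<Sum>D\<in>Pow (?U - A). \<Sum>\<sigma>\<in>inj_maps S N. \<Sum>\<tau>\<in>inj_maps T N.
        of_bool (A \<union> D \<subseteq> S) * of_bool (A \<union> D \<subseteq> T) * B ^ card D * Cx \<sigma> \<tau> A D)"
      by (rule sum.cong[OF refl], rule sum.swap)
    also have "\<dots> = (\<Sum>A\<in>Pow ?U. \<Sum>D\<in>Pow (?U - A). of_bool (A \<union> D \<subseteq> S) * of_bool (A \<union> D \<subseteq> T) * B ^ card D *
        (fact n / fact (n - card S)) * (fact (card A) * fact (n - card A - card D) / fact (n - card T)))"
    proof (rule sum.cong[OF refl], rule sum.cong[OF refl])
      fix A D assume A: "A \<in> Pow ?U" and D: "D \<in> Pow (?U - A)"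
      let ?c = "of_bool (A \<union> D \<subseteq> S) * of_bool (A \<union> D \<subseteq> T) * B ^ card D"
      show "(\<Sum>\<sigma>\<in>inj_maps S N. \<Sum>\<tau>\<in>inj_maps T N. ?c * Cx \<sigma> \<tau> A D) =
         ?c * (fact n / fact (n - card S)) * (fact (card A) * fact (n - card A - card D) / fact (n - card T))"
      proof (cases "A \<union> D \<subseteq> S \<inter> T")
        case False
        hence "?c = 0" by (auto simp del: Un_subset_iff)
        thus ?thesis by (simp only: mult_zero_left sum.neutral_const)
      next
        case True
        have "(\<Sum>\<tau>\<in>inj_maps T N. Cx \<sigma> \<tau> A D) = fact (card A) * fact (n - card A - card D) / fact (n - card T)"
          if "\<sigma> \<in> inj_maps S N" for \<sigma>
          unfolding Cx_def using sum_inj_maps_wick[of S T N A D \<sigma>, where 'a = 'a] that True D cS[OF S] cS[OF T] fN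
          by auto
        hence "(\<Sum>\<sigma>\<in>inj_maps S N. \<Sum>\<tau>\<in>inj_maps T N. ?c * Cx \<sigma> \<tau> A D) =
           of_nat (card (inj_maps S N)) * (?c * (fact (card A) * fact (n - card A - card D) / fact (n - card T)))"
          unfolding sum_distrib_left[symmetric] by simp
        also have "of_nat (card (inj_maps S N)) = (fact n / fact (n - card S) :: 'a)"
          using card_inj_maps[of S N, where 'a = 'a] cS[OF S] fN by simp
        finally show ?thesis by (simp only: mult_ac)
      qed
    qed
    finally show ?thesis .
  qed
  have "(\<Sum>S\<in>Pow ?U. \<Sum>T\<in>Pow ?U. x ^ (m - card S) * y ^ (m - card T) *
      (\<Sum>\<sigma>\<in>inj_maps S N. \<Sum>\<tau>\<in>inj_maps T N. \<Sum>A\<in>Pow ?U. \<Sum>D\<in>Pow (?U - A).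
        of_bool (A \<union> D \<subseteq> S \<inter> T \<and> (\<forall>j\<in>D. \<sigma> j = \<tau> j)) * B ^ card D *
        of_nat (card {\<pi>. \<pi> permutes A \<and> (\<forall>j\<in>A. \<tau> j = \<sigma> (\<pi> j))}))) =
     (\<Sum>S\<in>Pow ?U. \<Sum>T\<in>Pow ?U. \<Sum>A\<in>Pow ?U. \<Sum>D\<in>Pow (?U - A).
       (fact n * B ^ card D * fact (card A) * fact (n - card A - card D)) *
       ((of_bool (A \<union> D \<subseteq> S) * g x S) * (of_bool (A \<union> D \<subseteq> T) * g y T)))"
  proof (rule sum.cong[OF refl], rule sum.cong[OF refl], goal_cases)
    case (1 S T)
    show ?case
      unfolding inner[OF 1] sum_distrib_left
      by (rule sum.cong[OF refl], rule sum.cong[OF refl]) (simp add: g_def)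
  qed
  also have "\<dots> = (\<Sum>S\<in>Pow ?U. \<Sum>A\<in>Pow ?U. \<Sum>T\<in>Pow ?U. \<Sum>D\<in>Pow (?U - A).
       (fact n * B ^ card D * fact (card A) * fact (n - card A - card D)) *
       ((of_bool (A \<union> D \<subseteq> S) * g x S) * (of_bool (A \<union> D \<subseteq> T) * g y T)))"
    by (rule sum.cong[OF refl], rule sum.swap)
  also have "\<dots> = (\<Sum>A\<in>Pow ?U. \<Sum>S\<in>Pow ?U. \<Sum>T\<in>Pow ?U. \<Sum>D\<in>Pow (?U - A).
       (fact n * B ^ card D * fact (card A) * fact (n - card A - card D)) *
       ((of_bool (A \<union> D \<subseteq> S) * g x S) * (of_bool (A \<union> D \<subseteq> T) * g y T)))"
    by (rule sum.swap)
  also have "\<dots> = (\<Sum>A\<in>Pow ?U. \<Sum>S\<in>Pow ?U. \<Sum>D\<in>Pow (?U - A). \<Sum>T\<in>Pow ?U. 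
       (fact n * B ^ card D * fact (card A) * fact (n - card A - card D)) *
       ((of_bool (A \<union> D \<subseteq> S) * g x S) * (of_bool (A \<union> D \<subseteq> T) * g y T)))"
    by (rule sum.cong[OF refl], rule sum.cong[OF refl], rule sum.swap)
  also have "\<dots> = (\<Sum>A\<in>Pow ?U. \<Sum>D\<in>Pow (?U - A). \<Sum>S\<in>Pow ?U. \<Sum>T\<in>Pow ?U. 
       (fact n * B ^ card D * fact (card A) * fact (n - card A - card D)) *
       ((of_bool (A \<union> D \<subseteq> S) * g x S) * (of_bool (A \<union> D \<subseteq> T) * g y T)))"
    by (rule sum.cong[OF refl], rule sum.swap)
  also have "\<dots> = (\<Sum>A\<in>Pow ?U. \<Sum>D\<in>Pow (?U - A).
       (fact n * B ^ card D * fact (card A) * fact (n - card A - card D)) * (h A D x * h A D y))"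
    unfolding h_def sum_product by (simp only: sum_distrib_left)
  also have "\<dots> = (\<Sum>A\<in>Pow ?U. \<Sum>D\<in>Pow (?U - A). (\<lambda>a d. (fact n * B ^ d * fact a * fact (n - a - d)) *
        ((\<Sum>p\<le>m - a - d. of_nat ((m - a - d) choose p) * (x ^ p / fact (n - m + p))) *
        (\<Sum>q\<le>m - a - d. of_nat ((m - a - d) choose q) * (y ^ q / fact (n - m + q))))) (card A) (card D))"
    (is "_ = (\<Sum>A\<in>_. \<Sum>D\<in>_. ?k (card A) (card D))")
    by (rule sum.cong[OF refl], rule sum.cong[OF refl]) (simp only: hsum)
  also have "\<dots> = (\<Sum>A\<in>Pow ?U. (\<lambda>a. \<Sum>d\<le>m - a. of_nat ((m - a) choose d) * ?k a d) (card A))"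
  proof (rule sum.cong[OF refl])
    fix A assume "A \<in> Pow ?U"
    hence "card (?U - A) = m - card A" "finite A" by (auto simp: card_Diff_subset finite_subset)
    thus "(\<Sum>D\<in>Pow (?U - A). ?k (card A) (card D)) = (\<lambda>a. \<Sum>d\<le>m - a. of_nat ((m - a) choose d) * ?k a d) (card A)"
      using sum_Pow_card[of "?U - A" "\<lambda>d. ?k (card A) d"] by simp
  qed
  also have "\<dots> = (\<Sum>a\<le>m. of_nat (m choose a) * (\<Sum>d\<le>m - a. of_nat ((m - a) choose d) * ?k a d))"
    by (subst sum_Pow_card) auto
  also have "\<dots> = fact n * fact m * (\<Sum>a\<le>m. \<Sum>d\<le>m - a. B ^ d / fact d * (fact (n - a - d) / fact (m - a - d)) *
        (\<Sum>p\<le>m - a - d. of_nat ((m - a - d) choose p) * (x ^ p / fact (n - m + p))) *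
        (\<Sum>q\<le>m - a - d. of_nat ((m - a - d) choose q) * (y ^ q / fact (n - m + q))))"
    unfolding sum_distrib_left[of "fact n * fact m"] sum_distrib_left[of "of_nat (m choose _)"]
  proof (rule sum.cong[OF refl], rule sum.cong[OF refl])
    fix a d assume "a \<in> {..m}" "d \<in> {..m - a}"
    hence c: "of_nat (m choose a) = (fact m / (fact a * fact (m - a)) :: 'a)"
       "of_nat ((m - a) choose d) = (fact (m - a) / (fact d * fact (m - a - d)) :: 'a)"
      by (auto simp: binomial_fact)
    show "of_nat (m choose a) * (of_nat ((m - a) choose d) * ?k a d) =
       fact n * fact m * (B ^ d / fact d * (fact (n - a - d) / fact (m - a - d)) *
        (\<Sum>p\<le>m - a - d. of_nat ((m - a - d) choose p) * (x ^ p / fact (n - m + p))) *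
        (\<Sum>q\<le>m - a - d. of_nat ((m - a - d) choose q) * (y ^ q / fact (n - m + q))))"
      unfolding c by (simp add: divide_simps mult_ac)
  qed
  finally show ?thesis unfolding N_def .
qed

subsection \<open>Moments and expectations\<close>

lemma power_abs_le_one_plus_power4:
  fixes x :: real
  assumes "k \<le> 4"
  shows "\<bar>x\<bar> ^ k \<le> 1 + x ^ 4"
proof (cases "\<bar>x\<bar> \<le> 1")
  case True
  hence "\<bar>x\<bar> ^ k \<le> 1" by (simp add: power_le_one)
  thus ?thesis by (smt (verit) zero_le_even_power even_numeral)
next
  case False
  hence "\<bar>x\<bar> ^ k \<le> \<bar>x\<bar> ^ 4" using assms by (intro power_increasing) auto
  thus ?thesis by (simp add: power_even_abs_numeral)
qed

lemma (in prob_space) real_moments_of_distr: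
  fixes u :: "'a \<Rightarrow> real"
  assumes u: "u \<in> borel_measurable M" "distr M borel u = Q"
    and Q: "integrable Q (\<lambda>x. x ^ 4)" "prob_space.expectation Q (\<lambda>x. x) = 0"
      "prob_space.variance Q (\<lambda>x. x) = 1 / 2"
  shows "k \<le> 4 \<Longrightarrow> integrable M (\<lambda>\<omega>. u \<omega> ^ k)" "(\<integral>\<omega>. u \<omega> \<partial>M) = 0" "(\<integral>\<omega>. u \<omega> ^ 2 \<partial>M) = 1 / 2"
    "(\<integral>\<omega>. u \<omega> ^ 4 \<partial>M) = (\<integral>x. x ^ 4 \<partial>Q)"
proof -
  note [measurable] = u(1)
  have i4: "integrable M (\<lambda>\<omega>. u \<omega> ^ 4)"
    using Q(1) unfolding u(2)[symmetric] by (simp add: integrable_distr_eq)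
  show "integrable M (\<lambda>\<omega>. u \<omega> ^ k)" if "k \<le> 4"
  proof (rule Bochner_Integration.integrable_bound)
    show "integrable M (\<lambda>\<omega>. 1 + u \<omega> ^ 4)" using i4 by simp
    show "AE \<omega> in M. norm (u \<omega> ^ k) \<le> norm (1 + u \<omega> ^ 4)"
    proof (intro AE_I2)
      fix \<omega>
      have "norm (u \<omega> ^ k) \<le> 1 + u \<omega> ^ 4"
        using power_abs_le_one_plus_power4[OF that, of "u \<omega>"] by (simp add: power_abs)
      thus "norm (u \<omega> ^ k) \<le> norm (1 + u \<omega> ^ 4)" by simp
    qed
  qed simp
  show m: "(\<integral>\<omega>. u \<omega> \<partial>M) = 0" "(\<integral>\<omega>. u \<omega> ^ 4 \<partial>M) = (\<integral>x. x ^ 4 \<partial>Q)"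
    using Q(2) unfolding u(2)[symmetric] by (simp_all add: integral_distr)
  show "(\<integral>\<omega>. u \<omega> ^ 2 \<partial>M) = 1 / 2"
    using Q(3) unfolding Q(2) unfolding u(2)[symmetric] by (simp add: integral_distr)
qed

text \<open>With real part u and imaginary part v, E x^2 = E u^2 - E v^2 + 2 i E u E v vanishes,
  because the parts are independent, centred and of equal variance. The last value is E u^4 + 2 E
  u^2 E v^2 + E v^4 = 2 b + 1/2 = 2 + 2 (b - 3/4).\<close>

lemma (in prob_space) complex_moments:
  fixes x :: "'a \<Rightarrow> complex"
  assumes x: "x \<in> borel_measurable M"
    and ind: "indep_var borel (\<lambda>\<omega>. Re (x \<omega>)) borel (\<lambda>\<omega>. Im (x \<omega>))"
    and d: "distr M borel (\<lambda>\<omega>. Re (x \<omega>)) = Q" "distr M borel (\<lambda>\<omega>. Im (x \<omega>)) = Q"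
    and Q: "integrable Q (\<lambda>x. x ^ 4)" "prob_space.expectation Q (\<lambda>x. x) = 0"
      "prob_space.variance Q (\<lambda>x. x) = 1 / 2"
  defines "mom \<equiv> \<lambda>a b. (\<integral>\<omega>. cnj (x \<omega>) ^ a * x \<omega> ^ b \<partial>M)"
  shows "a \<le> 2 \<Longrightarrow> b \<le> 2 \<Longrightarrow> integrable M (\<lambda>\<omega>. cnj (x \<omega>) ^ a * x \<omega> ^ b)"
    and "mom 0 0 = 1" "mom 1 0 = 0" "mom 0 1 = 0" "mom 1 1 = 1" "mom 2 0 = 0" "mom 0 2 = 0"
      "mom 2 2 = 2 + complex_of_real (2 * ((\<integral>x. x ^ 4 \<partial>Q) - 3 / 4))"
proof -
  define u where "u \<omega> = Re (x \<omega>)" for \<omega>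
  define v where "v \<omega> = Im (x \<omega>)" for \<omega>
  have [measurable]: "x \<in> borel_measurable M" by fact
  have [measurable]: "cnj \<in> borel_measurable borel"
    by (intro borel_measurable_continuous_onI continuous_intros)
  have uv[measurable]: "u \<in> borel_measurable M" "v \<in> borel_measurable M"
    unfolding u_def v_def by measurable
  have xuv: "x \<omega> = of_real (u \<omega>) + \<i> * of_real (v \<omega>)" for \<omega>
    using complex_eq[of "x \<omega>"] by (simp add: u_def v_def)
  have ind': "indep_var borel u borel v" using ind by (simp add: u_def[abs_def] v_def[abs_def])
  note mu = real_moments_of_distr[OF uv(1) d(1)[folded u_def] Q]
  note mv = real_moments_of_distr[OF uv(2) d(2)[folded v_def] Q]
  have iu: "integrable M u" "integrable M (\<lambda>\<omega>. u \<omega> ^ 2)" "integrable M (\<lambda>\<omega>. u \<omega> ^ 4)"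
    using mu(1)[of 1] mu(1)[of 2] mu(1)[of 4] by auto
  have iv: "integrable M v" "integrable M (\<lambda>\<omega>. v \<omega> ^ 2)" "integrable M (\<lambda>\<omega>. v \<omega> ^ 4)"
    using mv(1)[of 1] mv(1)[of 2] mv(1)[of 4] by auto
  have "(\<integral>\<omega>. u \<omega> * v \<omega> \<partial>M) = (\<integral>\<omega>. u \<omega> \<partial>M) * (\<integral>\<omega>. v \<omega> \<partial>M)"
    and iuv: "integrable M (\<lambda>\<omega>. u \<omega> * v \<omega>)"
    using indep_var_lebesgue_integral[OF ind' iu(1) iv(1)] indep_var_integrable[OF ind' iu(1) iv(1)] .
  hence Euv: "(\<integral>\<omega>. u \<omega> * v \<omega> \<partial>M) = 0" using mu(2) by simp
  have ind2: "indep_var borel (\<lambda>\<omega>. u \<omega> ^ 2) borel (\<lambda>\<omega>. v \<omega> ^ 2)"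
    using indep_var_compose[OF ind', of "\<lambda>t. t ^ 2" borel "\<lambda>t. t ^ 2" borel] by (simp add: comp_def)
  have E22: "(\<integral>\<omega>. u \<omega> ^ 2 * v \<omega> ^ 2 \<partial>M) = 1 / 4"
    and i22: "integrable M (\<lambda>\<omega>. u \<omega> ^ 2 * v \<omega> ^ 2)"
    using indep_var_lebesgue_integral[OF ind2 iu(2) iv(2)] indep_var_integrable[OF ind2 iu(2) iv(2)]
      mu(3) mv(3) by auto
  have n2: "cmod (x \<omega>) ^ 2 = u \<omega> ^ 2 + v \<omega> ^ 2" for \<omega> by (simp add: cmod_power2 u_def v_def)
  have n4: "cmod (x \<omega>) ^ 4 = u \<omega> ^ 4 + 2 * (u \<omega> ^ 2 * v \<omega> ^ 2) + v \<omega> ^ 4" for \<omega>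
  proof -
    have "cmod (x \<omega>) ^ 4 = (cmod (x \<omega>) ^ 2) ^ 2" by (simp flip: power_mult)
    thus ?thesis unfolding n2 by (simp add: power2_sum flip: power_mult)
  qed
  show int: "integrable M (\<lambda>\<omega>. cnj (x \<omega>) ^ a * x \<omega> ^ b)" if "a \<le> 2" "b \<le> 2" for a b
  proof (rule Bochner_Integration.integrable_bound)
    show "integrable M (\<lambda>\<omega>. 1 + cmod (x \<omega>) ^ 4)" unfolding n4 using iu iv i22 by auto
    show "AE \<omega> in M. norm (cnj (x \<omega>) ^ a * x \<omega> ^ b) \<le> norm (1 + cmod (x \<omega>) ^ 4)"
    proof (intro AE_I2)
      fix \<omega>
      have "norm (cnj (x \<omega>) ^ a * x \<omega> ^ b) = \<bar>cmod (x \<omega>)\<bar> ^ (a + b)"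
        by (simp add: norm_mult norm_power power_add)
      also have "\<dots> \<le> 1 + cmod (x \<omega>) ^ 4"
        using that by (intro power_abs_le_one_plus_power4) auto
      finally show "norm (cnj (x \<omega>) ^ a * x \<omega> ^ b) \<le> norm (1 + cmod (x \<omega>) ^ 4)" by simp
    qed
  qed simp
  show "mom 0 0 = 1" by (simp add: mom_def prob_space)
  have m01: "(\<integral>\<omega>. x \<omega> \<partial>M) = 0"
    unfolding xuv using iu iv mu(2) mv(2) by simp
  show "mom 0 1 = 0" using m01 by (simp add: mom_def)
  show "mom 1 0 = 0" using m01 by (simp add: mom_def)
  have sq: "x \<omega> ^ 2 = of_real (u \<omega> ^ 2) - of_real (v \<omega> ^ 2) + 2 * \<i> * of_real (u \<omega> * v \<omega>)" for \<omega>
    by (simp add: xuv power2_eq_square algebra_simps)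
  have m02: "(\<integral>\<omega>. x \<omega> ^ 2 \<partial>M) = 0"
    unfolding sq using iu iv iuv
    by (simp add: mu(3) mv(3) Euv del: of_real_power of_real_mult)
  show "mom 0 2 = 0" using m02 by (simp add: mom_def)
  have "(\<integral>\<omega>. cnj (x \<omega> ^ 2) \<partial>M) = cnj (\<integral>\<omega>. x \<omega> ^ 2 \<partial>M)" by (rule Bochner_Integration.integral_cnj)
  thus "mom 2 0 = 0"
    by (simp only: mom_def power_0 mult_1_right complex_cnj_power m02 complex_cnj_zero)
  have "mom 1 1 = (\<integral>\<omega>. complex_of_real (cmod (x \<omega>) ^ 2) \<partial>M)"
    unfolding mom_def by (simp only: power_one_right complex_norm_square mult.commute)
  also have "\<dots> = of_real (\<integral>\<omega>. u \<omega> ^ 2 + v \<omega> ^ 2 \<partial>M)" unfolding n2 by (rule integral_complex_of_real)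
  also have "\<dots> = 1" using iu iv by (simp add: mu(3) mv(3))
  finally show "mom 1 1 = 1" .
  have "mom 2 2 = (\<integral>\<omega>. complex_of_real (cmod (x \<omega>) ^ 4) \<partial>M)"
  proof -
    have "cnj z ^ 2 * z ^ 2 = complex_of_real (cmod z ^ 4)" for z
    proof -
      have "complex_of_real (cmod z ^ 4) = (complex_of_real (cmod z ^ 2)) ^ 2"
        by (simp flip: of_real_power power_mult)
      also have "\<dots> = (z * cnj z) ^ 2" by (simp only: complex_norm_square)
      finally show ?thesis by (simp add: power_mult_distrib mult.commute)
    qed
    thus ?thesis by (simp only: mom_def)
  qed
  also have "\<dots> = of_real (\<integral>\<omega>. u \<omega> ^ 4 + 2 * (u \<omega> ^ 2 * v \<omega> ^ 2) + v \<omega> ^ 4 \<partial>M)"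
    unfolding n4 by (rule integral_complex_of_real)
  also have "(\<integral>\<omega>. u \<omega> ^ 4 + 2 * (u \<omega> ^ 2 * v \<omega> ^ 2) + v \<omega> ^ 4 \<partial>M) = 2 * (\<integral>x. x ^ 4 \<partial>Q) + 1 / 2"
    using iu iv i22 by (simp add: mu(4) mv(4) E22)
  finally show "mom 2 2 = 2 + complex_of_real (2 * ((\<integral>x. x ^ 4 \<partial>Q) - 3 / 4))"
    by (simp add: algebra_simps)
qed

text \<open>Rewritten over cells, the expectation becomes a product of moments of single entries by
  independence, and each column is then a pairing sum. The maps \<sigma>' and \<tau>' stand for
  \<sigma> and \<tau> composed with a permutation.\<close>

lemma has_bochner_integral_matching_product:
  fixes X :: "'w \<Rightarrow> complex mat"
  assumes iid: "iid_complex_matrix Q M n m X"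
    and Q: "integrable Q (\<lambda>x. x ^ 4)" "prob_space.expectation Q (\<lambda>x. x) = 0"
      "prob_space.variance Q (\<lambda>x. x) = 1 / 2"
    and S: "S \<subseteq> {..<m}" "\<And>j. j \<in> S \<Longrightarrow> \<sigma> j < n \<and> \<sigma>' j < n"
    and T: "T \<subseteq> {..<m}" "\<And>j. j \<in> T \<Longrightarrow> \<tau> j < n \<and> \<tau>' j < n"
  shows "has_bochner_integral M
     (\<lambda>\<omega>. (\<Prod>j\<in>S. cnj (X \<omega> $$ (\<sigma> j, j)) * X \<omega> $$ (\<sigma>' j, j)) *
          (\<Prod>j\<in>T. cnj (X \<omega> $$ (\<tau> j, j)) * X \<omega> $$ (\<tau>' j, j)))
     (\<Prod>j<m. of_bool (j \<in> S \<and> j \<in> T \<and> \<sigma> j = \<tau>' j \<and> \<tau> j = \<sigma>' j) +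
        (complex_of_real (2 * ((\<integral>x. x ^ 4 \<partial>Q) - 3 / 4)) *
           of_bool (j \<in> S \<and> j \<in> T \<and> \<sigma> j = \<tau> j \<and> \<sigma> j = \<sigma>' j \<and> \<tau> j = \<tau>' j) +
         of_bool ((j \<in> S \<longrightarrow> \<sigma> j = \<sigma>' j) \<and> (j \<in> T \<longrightarrow> \<tau> j = \<tau>' j))))"
proof -
  interpret prob_space M using iid by (simp add: iid_complex_matrix_def)
  let ?I = "{..<n} \<times> {..<m}"
  have ind: "indep_vars (\<lambda>_. borel) (\<lambda>ij \<omega>. X \<omega> $$ ij) ?I"
    using iid by (simp add: iid_complex_matrix_def)
  define a where "a i j = (of_bool (j \<in> S \<and> \<sigma> j = i) + of_bool (j \<in> T \<and> \<tau> j = i) :: nat)" for i j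
  define b where "b i j = (of_bool (j \<in> S \<and> \<sigma>' j = i) + of_bool (j \<in> T \<and> \<tau>' j = i) :: nat)" for i j
  define f where "f ij z = cnj z ^ a (fst ij) (snd ij) * z ^ b (fst ij) (snd ij)" for ij and z :: complex
  define B where "B = complex_of_real (2 * ((\<integral>x. x ^ 4 \<partial>Q) - 3 / 4))"
  define e where "e j = of_bool (j \<in> S \<and> j \<in> T \<and> \<sigma> j = \<tau>' j \<and> \<tau> j = \<sigma>' j) +
        (B * of_bool (j \<in> S \<and> j \<in> T \<and> \<sigma> j = \<tau> j \<and> \<sigma> j = \<sigma>' j \<and> \<tau> j = \<tau>' j) +
         of_bool ((j \<in> S \<longrightarrow> \<sigma> j = \<sigma>' j) \<and> (j \<in> T \<longrightarrow> \<tau> j = \<tau>' j)))" for j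
  define mom where "mom ij k l = (\<integral>\<omega>. cnj (X \<omega> $$ ij) ^ k * (X \<omega> $$ ij) ^ l \<partial>M)" for ij k l
  have mom: "integrable M (\<lambda>\<omega>. cnj (X \<omega> $$ ij) ^ k * (X \<omega> $$ ij) ^ l)" (is ?int)
    "mom ij 0 0 = 1 \<and> mom ij 1 0 = 0 \<and> mom ij 0 1 = 0 \<and> mom ij 1 1 = 1 \<and>
     mom ij 2 0 = 0 \<and> mom ij 0 2 = 0 \<and> mom ij 2 2 = 2 + B" (is ?val)
    if ij: "ij \<in> ?I" and kl: "k \<le> 2" "l \<le> 2" for ij k l
  proof -
    obtain i j where [simp]: "ij = (i, j)" and lt: "i < n" "j < m" using ij by auto
    have "random_variable borel (\<lambda>\<omega>. X \<omega> $$ (i, j))"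
      using ind ij by (auto simp: indep_vars_def)
    moreover have "indep_var borel (\<lambda>\<omega>. Re (X \<omega> $$ (i, j))) borel (\<lambda>\<omega>. Im (X \<omega> $$ (i, j)))"
      "distr M borel (\<lambda>\<omega>. Re (X \<omega> $$ (i, j))) = Q" "distr M borel (\<lambda>\<omega>. Im (X \<omega> $$ (i, j))) = Q"
      using iid lt by (simp_all add: iid_complex_matrix_def)
    note moms = complex_moments[OF calculation this Q]
    show ?int using moms(1)[OF kl] by simp
    show ?val using moms(2-) by (simp add: mom_def B_def)
  qed
  \<comment> \<open>Each determinant puts at most one factor of each kind into a cell, so the total
    order of a moment is at most 4.\<close>
  have le2: "a i j \<le> 2" "b i j \<le> 2" for i j by (auto simp: a_def b_def)
  have indf: "indep_vars (\<lambda>_. borel) (\<lambda>ij \<omega>. f ij (X \<omega> $$ ij)) ?I"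
    by (rule indep_vars_compose2[OF ind]) (auto simp: f_def intro!: borel_measurable_continuous_onI continuous_intros)
  have intf: "integrable M (\<lambda>\<omega>. f ij (X \<omega> $$ ij))" if "ij \<in> ?I" for ij
    unfolding f_def using mom(1)[OF that le2] .
  have "has_bochner_integral M (\<lambda>\<omega>. \<Prod>ij\<in>?I. f ij (X \<omega> $$ ij)) (\<Prod>ij\<in>?I. \<integral>\<omega>. f ij (X \<omega> $$ ij) \<partial>M)"
    unfolding has_bochner_integral_iff
    using indep_vars_lebesgue_integral[OF _ indf intf] indep_vars_integrable[OF _ indf intf] by simp
  also have "(\<lambda>\<omega>. \<Prod>ij\<in>?I. f ij (X \<omega> $$ ij)) =
     (\<lambda>\<omega>. (\<Prod>j\<in>S. cnj (X \<omega> $$ (\<sigma> j, j)) * X \<omega> $$ (\<sigma>' j, j)) *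
          (\<Prod>j\<in>T. cnj (X \<omega> $$ (\<tau> j, j)) * X \<omega> $$ (\<tau>' j, j)))"
  proof
    fix \<omega>
    let ?F = "\<lambda>i j. X \<omega> $$ (i, j)"
    have cells:
      "(\<Prod>j\<in>S. cnj (?F (\<sigma> j) j)) = (\<Prod>j<m. \<Prod>i<n. cnj (?F i j) ^ of_bool (j \<in> S \<and> \<sigma> j = i))"
      "(\<Prod>j\<in>S. ?F (\<sigma>' j) j) = (\<Prod>j<m. \<Prod>i<n. ?F i j ^ of_bool (j \<in> S \<and> \<sigma>' j = i))"
      "(\<Prod>j\<in>T. cnj (?F (\<tau> j) j)) = (\<Prod>j<m. \<Prod>i<n. cnj (?F i j) ^ of_bool (j \<in> T \<and> \<tau> j = i))"
      "(\<Prod>j\<in>T. ?F (\<tau>' j) j) = (\<Prod>j<m. \<Prod>i<n. ?F i j ^ of_bool (j \<in> T \<and> \<tau>' j = i))"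
      using S(2) T(2)
      by (intro prod_graph_eq_prod_cells[OF S(1), of _ n "\<lambda>i j. cnj (?F i j)"]
          prod_graph_eq_prod_cells[OF S(1), of _ n ?F]
          prod_graph_eq_prod_cells[OF T(1), of _ n "\<lambda>i j. cnj (?F i j)"]
          prod_graph_eq_prod_cells[OF T(1), of _ n ?F]; simp)+
    have "(\<Prod>ij\<in>?I. f ij (X \<omega> $$ ij)) = (\<Prod>i<n. \<Prod>j<m. f (i, j) (?F i j))"
      by (simp add: prod.cartesian_product split_beta)
    also have "\<dots> = (\<Prod>j<m. \<Prod>i<n. f (i, j) (?F i j))" by (rule prod.swap)
    also have "\<dots> = (\<Prod>j<m. \<Prod>i<n. (cnj (?F i j) ^ of_bool (j \<in> S \<and> \<sigma> j = i) * ?F i j ^ of_bool (j \<in> S \<and> \<sigma>' j = i)) *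
        (cnj (?F i j) ^ of_bool (j \<in> T \<and> \<tau> j = i) * ?F i j ^ of_bool (j \<in> T \<and> \<tau>' j = i)))"
      unfolding f_def a_def b_def fst_conv snd_conv power_add by (simp only: mult_ac)
    also have "\<dots> = (\<Prod>j\<in>S. cnj (?F (\<sigma> j) j) * ?F (\<sigma>' j) j) * (\<Prod>j\<in>T. cnj (?F (\<tau> j) j) * ?F (\<tau>' j) j)"
      by (simp only: prod.distrib cells)
    finally show "(\<Prod>ij\<in>?I. f ij (X \<omega> $$ ij)) = \<dots>" .
  qed
  also have "(\<Prod>ij\<in>?I. \<integral>\<omega>. f ij (X \<omega> $$ ij) \<partial>M) = (\<Prod>i<n. \<Prod>j<m. mom (i, j) (a i j) (b i j))"
    by (simp add: prod.cartesian_product split_beta f_def mom_def)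
  also have "\<dots> = (\<Prod>j<m. \<Prod>i<n. mom (i, j) (a i j) (b i j))" by (rule prod.swap)
  also have "\<dots> = (\<Prod>j<m. e j)"
  proof (intro prod.cong refl)
    fix j assume "j \<in> {..<m}"
    thus "(\<Prod>i<n. mom (i, j) (a i j) (b i j)) = e j"
      \<comment> \<open>The list of moments does not depend on the exponents \<open>0 0\<close>;
        they only discharge the bounds under which it was stated.\<close>
      unfolding a_def b_def e_def using S(2) T(2) mom(2)[of "(_, j)" 0 0]
      by (intro wick_column[where mom = "\<lambda>i. mom (i, j)"]) auto
  qed
  finally show ?thesis unfolding e_def B_def .
qed

text \<open>An exact formula at finite size. With r = m - a - d and \<alpha> = n - m, the inner sums
  are r!/(r+\<alpha>)! times classical Laguerre polynomials, so together with the factor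
  (r+\<alpha>)!/r! each term is a product of two such polynomials divided by their squared
  norm.\<close>

lemma char_poly_correlation_eq:
  fixes M :: "nat \<Rightarrow> nat \<Rightarrow> 'w measure"
  assumes iid: "iid_complex_matrix Q (M n m) n m (X n m)" and mn: "m \<le> n"
    and Q: "integrable Q (\<lambda>x. x ^ 4)" "prob_space.expectation Q (\<lambda>x. x) = 0"
      "prob_space.variance Q (\<lambda>x. x) = 1 / 2"
  defines "B \<equiv> complex_of_real (2 * ((\<integral>x. x ^ 4 \<partial>Q) - 3 / 4))"
  shows "char_poly_correlation M X n m \<mu> \<nu> =
     fact n * fact m * (\<Sum>a\<le>m. \<Sum>d\<le>m - a. B ^ d / fact d * (fact (n - a - d) / fact (m - a - d)) *
        (\<Sum>p\<le>m - a - d. of_nat ((m - a - d) choose p) * ((- \<mu>) ^ p / fact (n - m + p))) *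
        (\<Sum>q\<le>m - a - d. of_nat ((m - a - d) choose q) * ((- \<nu>) ^ q / fact (n - m + q))))"
proof -
  let ?U = "{..<m}"
  define Y where "Y \<omega> i j = X n m \<omega> $$ (i, j)" for \<omega> i j
  define t where "t \<omega> S \<sigma> \<pi> = (\<Prod>j\<in>S. cnj (Y \<omega> (\<sigma> j) j) * Y \<omega> (\<sigma> (\<pi> j)) j)" for \<omega> S and \<sigma> \<pi> :: "nat \<Rightarrow> nat"
  define E where "E S T \<sigma> \<tau> \<pi> \<rho> = (\<Prod>j\<in>?U. of_bool (j \<in> S \<and> j \<in> T \<and> \<sigma> j = \<tau> (\<rho> j) \<and> \<tau> j = \<sigma> (\<pi> j)) +
        (B * of_bool (j \<in> S \<and> j \<in> T \<and> \<sigma> j = \<tau> j \<and> \<sigma> j = \<sigma> (\<pi> j) \<and> \<tau> j = \<tau> (\<rho> j)) +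
         of_bool ((j \<in> S \<longrightarrow> \<sigma> j = \<sigma> (\<pi> j)) \<and> (j \<in> T \<longrightarrow> \<tau> j = \<tau> (\<rho> j)))))"
    for S T and \<sigma> \<tau> \<pi> \<rho> :: "nat \<Rightarrow> nat"
  have lt: "\<sigma> j < n \<and> \<sigma> (\<pi> j) < n" if "\<sigma> \<in> inj_maps S {..<n}" "\<pi> permutes S" "j \<in> S" for S \<sigma> \<pi> j
    using that permutes_in_image[OF that(2), of j] by (auto simp: inj_maps_def PiE_def Pi_def)
  have integral: "has_bochner_integral (M n m) (\<lambda>\<omega>. t \<omega> S \<sigma> \<pi> * t \<omega> T \<tau> \<rho>) (E S T \<sigma> \<tau> \<pi> \<rho>)"
    if "S \<in> Pow ?U" "T \<in> Pow ?U" "\<sigma> \<in> inj_maps S {..<n}" "\<tau> \<in> inj_maps T {..<n}"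
      "\<pi> \<in> {\<pi>. \<pi> permutes S}" "\<rho> \<in> {\<rho>. \<rho> permutes T}" for S T \<sigma> \<tau> \<pi> \<rho>
    unfolding t_def E_def Y_def B_def
    by (rule has_bochner_integral_matching_product[OF iid Q]) (use that lt in auto)
  have "has_bochner_integral (M n m)
     (\<lambda>\<omega>. \<Sum>S\<in>Pow ?U. \<Sum>T\<in>Pow ?U. (- \<mu>) ^ (m - card S) * (- \<nu>) ^ (m - card T) *
        (\<Sum>\<sigma>\<in>inj_maps S {..<n}. \<Sum>\<tau>\<in>inj_maps T {..<n}. \<Sum>\<pi> | \<pi> permutes S. \<Sum>\<rho> | \<rho> permutes T.
           of_int (sign \<pi>) * of_int (sign \<rho>) * (t \<omega> S \<sigma> \<pi> * t \<omega> T \<tau> \<rho>)))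
     (\<Sum>S\<in>Pow ?U. \<Sum>T\<in>Pow ?U. (- \<mu>) ^ (m - card S) * (- \<nu>) ^ (m - card T) *
        (\<Sum>\<sigma>\<in>inj_maps S {..<n}. \<Sum>\<tau>\<in>inj_maps T {..<n}. \<Sum>\<pi> | \<pi> permutes S. \<Sum>\<rho> | \<rho> permutes T.
           of_int (sign \<pi>) * of_int (sign \<rho>) * E S T \<sigma> \<tau> \<pi> \<rho>))"
    by (intro has_bochner_integral_sum has_bochner_integral_mult_right integral)
  moreover have "Determinant.det (sample_covariance (X n m \<omega>) - \<mu> \<cdot>\<^sub>m 1\<^sub>m m) *
      Determinant.det (sample_covariance (X n m \<omega>) - \<nu> \<cdot>\<^sub>m 1\<^sub>m m) =
     (\<Sum>S\<in>Pow ?U. \<Sum>T\<in>Pow ?U. (- \<mu>) ^ (m - card S) * (- \<nu>) ^ (m - card T) *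
        (\<Sum>\<sigma>\<in>inj_maps S {..<n}. \<Sum>\<tau>\<in>inj_maps T {..<n}. \<Sum>\<pi> | \<pi> permutes S. \<Sum>\<rho> | \<rho> permutes T.
           of_int (sign \<pi>) * of_int (sign \<rho>) * (t \<omega> S \<sigma> \<pi> * t \<omega> T \<tau> \<rho>)))"
    if "\<omega> \<in> space (M n m)" for \<omega>
  proof -
    \<comment> \<open>The dimensions of the matrix are known only on \<open>space (M n m)\<close>;
      this suffices, since the integral sees no other points.\<close>
    have A: "X n m \<omega> \<in> carrier_mat n m" using iid that by (simp add: iid_complex_matrix_def)
    have det: "Determinant.det (sample_covariance (X n m \<omega>) - z \<cdot>\<^sub>m 1\<^sub>m m) = (\<Sum>S\<in>Pow ?U. (- z) ^ (m - card S) *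
       (\<Sum>\<sigma>\<in>inj_maps S {..<n}. \<Sum>\<pi> | \<pi> permutes S. of_int (sign \<pi>) * t \<omega> S \<sigma> \<pi>))" for z
      unfolding det_sample_covariance_expand[OF A] t_def Y_def ..
    show ?thesis
      unfolding det sum_product
    proof (rule sum.cong[OF refl], rule sum.cong[OF refl])
      fix S T
      have "(\<Sum>\<sigma>\<in>inj_maps S {..<n}. \<Sum>\<pi> | \<pi> permutes S. of_int (sign \<pi>) * t \<omega> S \<sigma> \<pi>) *
         (\<Sum>\<tau>\<in>inj_maps T {..<n}. \<Sum>\<rho> | \<rho> permutes T. of_int (sign \<rho>) * t \<omega> T \<tau> \<rho>) =
        (\<Sum>\<sigma>\<in>inj_maps S {..<n}. \<Sum>\<tau>\<in>inj_maps T {..<n}. \<Sum>\<pi> | \<pi> permutes S. \<Sum>\<rho> | \<rho> permutes T.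
           of_int (sign \<pi>) * of_int (sign \<rho>) * (t \<omega> S \<sigma> \<pi> * t \<omega> T \<tau> \<rho>))"
        unfolding sum_product by (simp only: mult_ac)
      from arg_cong[OF this, of "\<lambda>s. (- \<mu>) ^ (m - card S) * (- \<nu>) ^ (m - card T) * s"]
      show "(- \<mu>) ^ (m - card S) * (\<Sum>\<sigma>\<in>inj_maps S {..<n}. \<Sum>\<pi> | \<pi> permutes S. of_int (sign \<pi>) * t \<omega> S \<sigma> \<pi>) *
         ((- \<nu>) ^ (m - card T) * (\<Sum>\<tau>\<in>inj_maps T {..<n}. \<Sum>\<rho> | \<rho> permutes T. of_int (sign \<rho>) * t \<omega> T \<tau> \<rho>)) =
        (- \<mu>) ^ (m - card S) * (- \<nu>) ^ (m - card T) *
        (\<Sum>\<sigma>\<in>inj_maps S {..<n}. \<Sum>\<tau>\<in>inj_maps T {..<n}. \<Sum>\<pi> | \<pi> permutes S. \<Sum>\<rho> | \<rho> permutes T.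
           of_int (sign \<pi>) * of_int (sign \<rho>) * (t \<omega> S \<sigma> \<pi> * t \<omega> T \<tau> \<rho>))"
        by (simp only: mult_ac)
    qed
  qed
  ultimately have "char_poly_correlation M X n m \<mu> \<nu> =
     (\<Sum>S\<in>Pow ?U. \<Sum>T\<in>Pow ?U. (- \<mu>) ^ (m - card S) * (- \<nu>) ^ (m - card T) *
        (\<Sum>\<sigma>\<in>inj_maps S {..<n}. \<Sum>\<tau>\<in>inj_maps T {..<n}. \<Sum>\<pi> | \<pi> permutes S. \<Sum>\<rho> | \<rho> permutes T.
           of_int (sign \<pi>) * of_int (sign \<rho>) * E S T \<sigma> \<tau> \<pi> \<rho>))"
    unfolding char_poly_correlation_def
    by (subst Bochner_Integration.integral_cong[OF refl]) (auto intro: has_bochner_integral_integral_eq)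
  also have "\<dots> = (\<Sum>S\<in>Pow ?U. \<Sum>T\<in>Pow ?U. (- \<mu>) ^ (m - card S) * (- \<nu>) ^ (m - card T) *
      (\<Sum>\<sigma>\<in>inj_maps S {..<n}. \<Sum>\<tau>\<in>inj_maps T {..<n}. \<Sum>A\<in>Pow ?U. \<Sum>D\<in>Pow (?U - A).
        of_bool (A \<union> D \<subseteq> S \<inter> T \<and> (\<forall>j\<in>D. \<sigma> j = \<tau> j)) * B ^ card D *
        of_nat (card {\<pi>. \<pi> permutes A \<and> (\<forall>j\<in>A. \<tau> j = \<sigma> (\<pi> j))})))"
  proof (rule sum.cong[OF refl], rule sum.cong[OF refl], rule arg_cong2[where f = "(*)"],
      rule refl, rule sum.cong[OF refl], rule sum.cong[OF refl])
    fix S T \<sigma> \<tau>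
    assume "S \<in> Pow ?U" "T \<in> Pow ?U" "\<sigma> \<in> inj_maps S {..<n}" "\<tau> \<in> inj_maps T {..<n}"
    thus "(\<Sum>\<pi> | \<pi> permutes S. \<Sum>\<rho> | \<rho> permutes T. of_int (sign \<pi>) * of_int (sign \<rho>) * E S T \<sigma> \<tau> \<pi> \<rho>) =
      (\<Sum>A\<in>Pow ?U. \<Sum>D\<in>Pow (?U - A).
        of_bool (A \<union> D \<subseteq> S \<inter> T \<and> (\<forall>j\<in>D. \<sigma> j = \<tau> j)) * B ^ card D *
        of_nat (card {\<pi>. \<pi> permutes A \<and> (\<forall>j\<in>A. \<tau> j = \<sigma> (\<pi> j))}))"
      unfolding E_def by (intro sum_permutes_wick) (auto simp: inj_maps_def)
  qed
  also note sum_wick_total[OF mn, of "- \<mu>" "- \<nu>" B]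
  finally show ?thesis .
qed

subsection \<open>Dominated convergence and falling factorials\<close>

text \<open>Tannery's theorem for unconditional sums. Where the bound holds, the Weierstrass test
  makes the finite partial sums converge uniformly in the parameter, which permits the interchange
  of limits.\<close>

lemma infsum_dominated_tendsto:
  fixes f :: "'n \<Rightarrow> 'i \<Rightarrow> 'c :: banach"
  assumes lim: "\<And>i. ((\<lambda>n. f n i) \<longlongrightarrow> g i) F"
    and bound: "eventually (\<lambda>n. \<forall>i. norm (f n i) \<le> M i) F"
    and M: "M summable_on UNIV" and F: "F \<noteq> bot"
  shows "((\<lambda>n. \<Sum>\<^sub>\<infinity>i. f n i) \<longlongrightarrow> (\<Sum>\<^sub>\<infinity>i. g i)) F"
proof (rule swap_uniform_limit')
  show "\<forall>\<^sub>F X in finite_subsets_at_top UNIV. ((\<lambda>n. \<Sum>i\<in>X. f n i) \<longlongrightarrow> (\<Sum>i\<in>X. g i)) F"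
    by (intro always_eventually allI tendsto_sum lim)
  have gM: "norm (g i) \<le> M i" for i
    by (rule tendsto_upperbound[OF tendsto_norm[OF lim]])
       (use bound F in \<open>auto elim: eventually_mono\<close>)
  have "g summable_on UNIV"
    by (rule abs_summable_summable, rule Infinite_Sum.abs_summable_on_comparison_test'[OF M]) (rule gM)
  thus "((\<lambda>X. \<Sum>i\<in>X. g i) \<longlongrightarrow> (\<Sum>\<^sub>\<infinity>i. g i)) (finite_subsets_at_top UNIV)"
    using has_sum_infsum has_sum_def by blast
  show "uniform_limit {n. \<forall>i. norm (f n i) \<le> M i} (\<lambda>X n. \<Sum>i\<in>X. f n i) (\<lambda>n. \<Sum>\<^sub>\<infinity>i. f n i)
      (finite_subsets_at_top UNIV)"
    by (rule Weierstrass_m_test_general[OF _ M]) auto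
qed (use bound in auto)

section \<open>Absolutely summable product families and the exponential series\<close>

lemma
  fixes f :: "'i \<Rightarrow> real" and g :: "'j \<Rightarrow> real"
  assumes f: "(\<lambda>i. norm (f i)) summable_on UNIV" and g: "(\<lambda>j. norm (g j)) summable_on UNIV"
  shows abs_summable_on_times: "(\<lambda>z. norm (case z of (i, j) \<Rightarrow> f i * g j)) summable_on UNIV"
    and infsum_times: "(\<Sum>\<^sub>\<infinity>(i, j). f i * g j) = (\<Sum>\<^sub>\<infinity>i. f i) * (\<Sum>\<^sub>\<infinity>j. g j)"
proof -
  have "(\<lambda>z. norm (case z of (i, j) \<Rightarrow> f i * g j)) summable_on UNIV \<times> UNIV"
    unfolding Infinite_Sum.abs_summable_on_Sigma_iff
    using f g by (auto simp: abs_mult infsum_cmult_right' intro!: summable_on_cmult_right summable_on_cmult_left)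
  thus *: "(\<lambda>z. norm (case z of (i, j) \<Rightarrow> f i * g j)) summable_on UNIV" by simp
  have "(\<Sum>\<^sub>\<infinity>i. \<Sum>\<^sub>\<infinity>j. (\<lambda>(i, j). f i * g j) (i, j)) = infsum (\<lambda>(i, j). f i * g j) (UNIV \<times> UNIV)"
    by (rule infsum_Sigma_banach) (use abs_summable_summable[OF *] in simp)
  thus "(\<Sum>\<^sub>\<infinity>(i, j). f i * g j) = (\<Sum>\<^sub>\<infinity>i. f i) * (\<Sum>\<^sub>\<infinity>j. g j)"
    by (simp add: infsum_cmult_right' infsum_cmult_left')
qed

lemma abs_summable_on_exp: "(\<lambda>n. norm (x ^ n / fact n :: real)) summable_on UNIV"
proof (rule norm_summable_imp_summable_on)
  have "summable (\<lambda>n. \<bar>x\<bar> ^ n /\<^sub>R fact n)" by (rule summable_exp_generic)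
  thus "summable (\<lambda>n. norm (norm (x ^ n / fact n)))"
    by (simp add: power_abs abs_mult divide_inverse_commute)
qed

lemma infsum_exp: "(\<Sum>\<^sub>\<infinity>n. x ^ n / fact n) = exp (x :: real)"
proof -
  have "(\<lambda>n. x ^ n / fact n) sums exp x"
    using exp_converges[of x] by (simp add: divide_inverse_commute)
  moreover have "summable (\<lambda>n. norm (x ^ n / fact n))"
    using abs_summable_on_exp[of x] by (simp add: summable_on_UNIV_nonneg_real_iff)
  ultimately show ?thesis by (intro infsumI norm_summable_imp_has_sum)
qed

text \<open>With truncated subtraction both sides vanish for \<open>p > r\<close>.\<close>
lemma prod_diff_eq_fact_times_binomial: "(\<Prod>i<p. real (r - i)) = fact p * real (r choose p)"
proof (induction p)
  case (Suc p)
  have "real (r - p) * (fact p * real (r choose p)) = fact p * real ((r - p) * (r choose p))"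
    by simp
  also have "(r - p) * (r choose p) = Suc p * (r choose Suc p)"
  proof (cases "p \<le> r")
    case True
    thus ?thesis using binomial_absorb_comp[of r p] binomial_absorption[of p "r"]
      by (metis Suc_times_binomial_add binomial_absorb_comp choose_mult_lemma le_add_diff_inverse)
  qed (simp add: binomial_eq_0)
  finally show ?case using Suc by (simp add: algebra_simps)
qed simp

lemma prod_diff_eq_fact_div: "(\<Prod>i<k. real (r + k - i)) = fact (r + k) / fact r"
  unfolding prod_diff_eq_fact_times_binomial by (simp add: binomial_fact)

text \<open>A discrete comparison with the integral of t^D: the difference of (s+1)^(D+1) and
  s^(D+1) factors into D + 1 products, each between s^D and (s+1)^D, and these differences
  telescope.\<close>

lemma sum_power_bounds:
  shows "(\<Sum>s<n. real s ^ D) \<le> real n ^ Suc D / real (Suc D)"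
    and "real n ^ Suc D / real (Suc D) \<le> (\<Sum>s<n. real (Suc s) ^ D)"
proof -
  have *: "real (Suc s) ^ Suc D - real s ^ Suc D = (\<Sum>i<Suc D. real s ^ (D - i) * real (Suc s) ^ i)" for s
    using power_diff_sumr2[of "real (Suc s)" "Suc D" "real s"] by (simp del: sum.lessThan_Suc)
  have l: "real (Suc D) * real s ^ D \<le> real (Suc s) ^ Suc D - real s ^ Suc D" for s
  proof -
    have "(\<Sum>i<Suc D. real s ^ D) \<le> (\<Sum>i<Suc D. real s ^ (D - i) * real (Suc s) ^ i)"
    proof (rule sum_mono)
      fix i assume "i \<in> {..<Suc D}"
      hence "real s ^ D = real s ^ (D - i) * real s ^ i" by (simp flip: power_add)
      also have "\<dots> \<le> real s ^ (D - i) * real (Suc s) ^ i"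
        by (intro mult_left_mono power_mono) auto
      finally show "real s ^ D \<le> real s ^ (D - i) * real (Suc s) ^ i" .
    qed
    thus ?thesis unfolding * by (simp only: sum_constant card_lessThan)
  qed
  have u: "real (Suc s) ^ Suc D - real s ^ Suc D \<le> real (Suc D) * real (Suc s) ^ D" for s
  proof -
    have "(\<Sum>i<Suc D. real s ^ (D - i) * real (Suc s) ^ i) \<le> (\<Sum>i<Suc D. real (Suc s) ^ D)"
    proof (rule sum_mono)
      fix i assume "i \<in> {..<Suc D}"
      hence "real (Suc s) ^ D = real (Suc s) ^ (D - i) * real (Suc s) ^ i" by (simp flip: power_add)
      also have "\<dots> \<ge> real s ^ (D - i) * real (Suc s) ^ i"
        by (intro mult_right_mono power_mono) auto
      finally show "real s ^ (D - i) * real (Suc s) ^ i \<le> real (Suc s) ^ D" .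
    qed
    thus ?thesis unfolding * by (simp only: sum_constant card_lessThan)
  qed
  have tel: "(\<Sum>s<n. real (Suc s) ^ Suc D - real s ^ Suc D) = real n ^ Suc D"
    using sum_lessThan_telescope[of "\<lambda>s. real s ^ Suc D" n] by simp
  have "(\<Sum>s<n. real (Suc D) * real s ^ D) \<le> real n ^ Suc D"
    unfolding tel[symmetric] by (intro sum_mono l)
  thus "(\<Sum>s<n. real s ^ D) \<le> real n ^ Suc D / real (Suc D)"
    unfolding sum_distrib_left[symmetric] by (simp add: field_simps)
  have "real n ^ Suc D \<le> (\<Sum>s<n. real (Suc D) * real (Suc s) ^ D)"
    unfolding tel[symmetric] by (intro sum_mono u)
  thus "real n ^ Suc D / real (Suc D) \<le> (\<Sum>s<n. real (Suc s) ^ D)"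
    unfolding sum_distrib_left[symmetric] by (simp add: field_simps)
qed

text \<open>Up to Bessel coefficients and the weight B^d/d!, this is the coefficient of x^p y^q in
  the Laguerre sum for fixed \<open>d\<close>. The factorials turn the binomials into falling
  factorials, so the summand is monic in \<open>r\<close>, of degree
  \<open>\<alpha> + p + q\<close>. The range is additive because truncated subtraction would keep
  \<open>r = 0\<close> for large \<open>d\<close>.\<close>

definition falling_sum :: "nat \<Rightarrow> nat \<Rightarrow> nat \<Rightarrow> nat \<Rightarrow> nat \<Rightarrow> real" where
  "falling_sum \<alpha> p q N d = (\<Sum>r | r + \<alpha> + d \<le> N. fact (r + \<alpha>) / fact r *
     (fact p * real (r choose p)) * (fact q * real (r choose q)))"

text \<open>The summand is a product of \<open>\<alpha> + p + q\<close> factors, each between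
  \<open>r - (p + q)\<close> and \<open>r + \<alpha>\<close>. Replacing all of them by these
  extremes leaves sums of pure powers.\<close>

lemma falling_sum_bounds:
  shows "falling_sum \<alpha> p q N d \<le> real (Suc N) ^ Suc (\<alpha> + p + q) / real (Suc (\<alpha> + p + q))"
    and "real (N - (\<alpha> + d + p + q)) ^ Suc (\<alpha> + p + q) / real (Suc (\<alpha> + p + q)) \<le> falling_sum \<alpha> p q N d"
    and "0 \<le> falling_sum \<alpha> p q N d"
proof -
  let ?D = "\<alpha> + p + q"
  define h where "h r = fact (r + \<alpha>) / fact r * (fact p * real (r choose p)) * (fact q * real (r choose q))" for r
  have h: "h r = (\<Prod>i<\<alpha>. real (r + \<alpha> - i)) * (\<Prod>i<p. real (r - i)) * (\<Prod>i<q. real (r - i))" for r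
    unfolding h_def prod_diff_eq_fact_times_binomial[symmetric] prod_diff_eq_fact_div ..
  have up: "h r \<le> real (r + \<alpha>) ^ ?D" for r
  proof -
    have "(\<Prod>i<\<alpha>. real (r + \<alpha> - i)) * (\<Prod>i<p. real (r - i)) * (\<Prod>i<q. real (r - i)) \<le>
       (\<Prod>i<\<alpha>. real (r + \<alpha>)) * (\<Prod>i<p. real (r + \<alpha>)) * (\<Prod>i<q. real (r + \<alpha>))"
      by (intro mult_mono prod_mono mult_nonneg_nonneg prod_nonneg) auto
    thus ?thesis unfolding h by (simp add: power_add)
  qed
  have low: "real (r - (p + q)) ^ ?D \<le> h r" for r
  proof -
    have "(\<Prod>i<\<alpha>. real (r - (p + q))) * (\<Prod>i<p. real (r - (p + q))) * (\<Prod>i<q. real (r - (p + q))) \<le>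
       (\<Prod>i<\<alpha>. real (r + \<alpha> - i)) * (\<Prod>i<p. real (r - i)) * (\<Prod>i<q. real (r - i))"
      by (intro mult_mono prod_mono mult_nonneg_nonneg prod_nonneg) auto
    thus ?thesis unfolding h by (simp add: power_add)
  qed
  have h0: "0 \<le> h r" for r by (simp add: h_def)
  have S: "falling_sum \<alpha> p q N d = (\<Sum>r | r + \<alpha> + d \<le> N. h r)"
    by (simp add: falling_sum_def h_def)
  have fin: "finite {r. r + \<alpha> + d \<le> N}" by (rule finite_subset[of _ "{..N}"]) auto
  show "0 \<le> falling_sum \<alpha> p q N d" unfolding S by (intro sum_nonneg h0)
  have "falling_sum \<alpha> p q N d \<le> (\<Sum>r | r + \<alpha> + d \<le> N. real (r + \<alpha>) ^ ?D)"
    unfolding S by (intro sum_mono up)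
  \<comment> \<open>The shifted index s = r + \<alpha> stays at most \<open>N\<close>, whatever
    \<open>d\<close> is; this makes the upper bound uniform in \<open>d\<close>.\<close>
  also have "\<dots> = (\<Sum>s\<in>(\<lambda>r. r + \<alpha>) ` {r. r + \<alpha> + d \<le> N}. real s ^ ?D)"
    by (subst sum.reindex) (auto simp: inj_on_def)
  also have "\<dots> \<le> (\<Sum>s<Suc N. real s ^ ?D)"
    by (intro sum_mono2) auto
  also have "\<dots> \<le> real (Suc N) ^ Suc ?D / real (Suc ?D)" by (rule sum_power_bounds)
  finally show "falling_sum \<alpha> p q N d \<le> real (Suc N) ^ Suc ?D / real (Suc ?D)" .
  \<comment> \<open>For r = s + 1 + p + q the lower bound on each factor is s + 1. With this length
    the largest such \<open>r\<close> is \<open>N - \<alpha> - d\<close>; for small \<open>N\<close>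
    the subtraction truncates to an empty sum.\<close>
  let ?n = "N - (\<alpha> + d + p + q)"
  have "real ?n ^ Suc ?D / real (Suc ?D) \<le> (\<Sum>s<?n. real (Suc s) ^ ?D)"
    by (rule sum_power_bounds)
  also have "\<dots> = (\<Sum>r\<in>(\<lambda>s. Suc s + (p + q)) ` {..<?n}. real (r - (p + q)) ^ ?D)"
    by (subst sum.reindex) (auto simp: inj_on_def)
  also have "\<dots> \<le> (\<Sum>r\<in>(\<lambda>s. Suc s + (p + q)) ` {..<?n}. h r)"
    by (intro sum_mono low)
  also have "\<dots> \<le> falling_sum \<alpha> p q N d"
    unfolding S by (intro sum_mono2 fin) (auto simp: h0)
  finally show "real ?n ^ Suc ?D / real (Suc ?D) \<le> falling_sum \<alpha> p q N d" .
qed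

text \<open>Uniform in \<open>d\<close> and only geometric in \<open>p\<close> and \<open>q\<close>,
  so the factorials of the Bessel coefficients dominate it. The base 2 comes from (N+1)/N \<le>
  2.\<close>

lemma falling_sum_scaled_bound:
  assumes "N > 0"
  shows "\<bar>falling_sum \<alpha> p q N d / real N ^ Suc (\<alpha> + p + q)\<bar> \<le> 2 ^ Suc (\<alpha> + p + q)"
proof -
  have "falling_sum \<alpha> p q N d \<le> real (Suc N) ^ Suc (\<alpha> + p + q) / real (Suc (\<alpha> + p + q))"
    by (rule falling_sum_bounds)
  also have "\<dots> \<le> real (Suc N) ^ Suc (\<alpha> + p + q) / 1"
    by (intro divide_left_mono) auto
  also have "\<dots> \<le> (2 * real N) ^ Suc (\<alpha> + p + q)"
    unfolding div_by_1 using assms by (intro power_mono) auto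
  finally have "falling_sum \<alpha> p q N d / real N ^ Suc (\<alpha> + p + q) \<le> 2 ^ Suc (\<alpha> + p + q)"
    using assms unfolding power_mult_distrib by (simp add: divide_le_eq)
  thus ?thesis using falling_sum_bounds(3)[of \<alpha> p q N d] by simp
qed

text \<open>The limit is the integral of t^(\<alpha>+p+q) over [0,1]. Lowering the end of the range
  by a fixed \<open>d\<close> is an effect of lower order.\<close>

lemma falling_sum_scaled_tendsto:
  "(\<lambda>N. falling_sum \<alpha> p q N d / real N ^ Suc (\<alpha> + p + q)) \<longlonglongrightarrow> 1 / real (Suc (\<alpha> + p + q))"
proof -
  define c where "c = real (\<alpha> + d + p + q)"
  let ?D = "Suc (\<alpha> + p + q)"
  have "(\<lambda>N. (real N - c) / real N) \<longlonglongrightarrow> 1" by real_asymp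
  hence low: "(\<lambda>N. ((real N - c) / real N) ^ ?D / real ?D) \<longlonglongrightarrow> 1 ^ ?D / real ?D"
    by (intro tendsto_intros) auto
  have "(\<lambda>N. real (Suc N) / real N) \<longlonglongrightarrow> 1" by real_asymp
  hence up: "(\<lambda>N. (real (Suc N) / real N) ^ ?D / real ?D) \<longlonglongrightarrow> 1 ^ ?D / real ?D"
    by (intro tendsto_intros) auto
  have "(\<lambda>N. falling_sum \<alpha> p q N d / real N ^ ?D) \<longlonglongrightarrow> 1 ^ ?D / real ?D"
  proof (rule tendsto_sandwich[OF _ _ low up])
    show "\<forall>\<^sub>F N in sequentially. ((real N - c) / real N) ^ ?D / real ?D \<le> falling_sum \<alpha> p q N d / real N ^ ?D"
      using eventually_ge_at_top[of "\<alpha> + d + p + q"]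
    proof eventually_elim
      case (elim N)
      hence "real N - c = real (N - (\<alpha> + d + p + q))" by (simp add: c_def of_nat_diff)
      thus ?case using divide_right_mono[OF falling_sum_bounds(2)[of N \<alpha> d p q], of "real N ^ ?D"]
        by (simp add: power_divide mult.commute del: power_Suc)
    qed
    show "\<forall>\<^sub>F N in sequentially. falling_sum \<alpha> p q N d / real N ^ ?D \<le> (real (Suc N) / real N) ^ ?D / real ?D"
    proof (intro always_eventually allI)
      fix N
      show "falling_sum \<alpha> p q N d / real N ^ ?D \<le> (real (Suc N) / real N) ^ ?D / real ?D"
        using divide_right_mono[OF falling_sum_bounds(1)[of \<alpha> p q N d], of "real N ^ ?D"]
        by (simp add: power_divide mult.commute del: power_Suc)
    qed
  qed
  thus ?thesis by simp
qed

subsection \<open>The rescaled Laguerre sum\<close>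

text \<open>The Taylor coefficients of the entire function J_\<alpha>(2 sqrt x) / x^(\<alpha>/2).
  The arguments of the kernel therefore enter divided by 4.\<close>

definition bessel_coeff :: "nat \<Rightarrow> nat \<Rightarrow> real" where
  "bessel_coeff \<alpha> p = (- 1) ^ p / (fact p * fact (p + \<alpha>))"

text \<open>With g the power series of these coefficients, this is the integral of t^\<alpha> g(x t)
  g(y t) over [0,1]: the integral representation of the Bessel kernel up to a prefactor. Unlike the
  quotient it has no exceptional diagonal.\<close>

definition bessel_kernel_series :: "nat \<Rightarrow> real \<Rightarrow> real \<Rightarrow> real" where
  "bessel_kernel_series \<alpha> x y =
     (\<Sum>\<^sub>\<infinity>(p, q). bessel_coeff \<alpha> p * x ^ p * (bessel_coeff \<alpha> q * y ^ q) / real (Suc (\<alpha> + p + q)))"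

lemma abs_bessel_coeff_le: "\<bar>bessel_coeff \<alpha> p\<bar> \<le> 1 / fact p"
proof -
  have "1 \<le> (fact (p + \<alpha>) :: real)" by (rule fact_ge_1)
  hence "fact p * 1 \<le> fact p * (fact (p + \<alpha>) :: real)" by (intro mult_left_mono) auto
  thus ?thesis by (auto simp: bessel_coeff_def abs_mult power_abs intro!: divide_left_mono)
qed

lemma abs_bessel_term_le: "\<bar>bessel_coeff \<alpha> p * x ^ p\<bar> \<le> \<bar>x\<bar> ^ p / fact p"
  using mult_right_mono[OF abs_bessel_coeff_le[of \<alpha> p], of "\<bar>x\<bar> ^ p"]
  by (simp add: abs_mult power_abs)

lemma summable_on_exp_product:
  "(\<lambda>(p, q). \<bar>x\<bar> ^ p / fact p * (\<bar>y\<bar> ^ q / fact q) :: real) summable_on UNIV"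
  using abs_summable_on_times[OF abs_summable_on_exp[of "\<bar>x\<bar>"] abs_summable_on_exp[of "\<bar>y\<bar>"]]
  by (rule abs_summable_summable)

lemma abs_bessel_kernel_term_le:
  "\<bar>bessel_coeff \<alpha> p * x ^ p * (bessel_coeff \<alpha> q * y ^ q) / real (Suc (\<alpha> + p + q))\<bar> \<le>
     \<bar>x\<bar> ^ p / fact p * (\<bar>y\<bar> ^ q / fact q)"
proof -
  have "\<bar>bessel_coeff \<alpha> p * x ^ p * (bessel_coeff \<alpha> q * y ^ q) / real (Suc (\<alpha> + p + q))\<bar> =
    \<bar>bessel_coeff \<alpha> p * x ^ p\<bar> * \<bar>bessel_coeff \<alpha> q * y ^ q\<bar> / real (Suc (\<alpha> + p + q))"
    by (simp add: abs_mult)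
  also have "\<dots> \<le> \<bar>bessel_coeff \<alpha> p * x ^ p\<bar> * \<bar>bessel_coeff \<alpha> q * y ^ q\<bar> / 1"
    by (intro divide_left_mono mult_nonneg_nonneg) auto
  also have "\<dots> \<le> \<bar>x\<bar> ^ p / fact p * (\<bar>y\<bar> ^ q / fact q)"
    unfolding div_by_1 by (intro mult_mono abs_bessel_term_le) auto
  finally show ?thesis .
qed

lemma abs_summable_bessel_kernel_series:
  "(\<lambda>z. norm (case z of (p, q) \<Rightarrow>
     bessel_coeff \<alpha> p * x ^ p * (bessel_coeff \<alpha> q * y ^ q) / real (Suc (\<alpha> + p + q)))) summable_on UNIV"
  by (rule Infinite_Sum.abs_summable_on_comparison_test'[OF summable_on_exp_product[of x y]])
     (use abs_bessel_kernel_term_le in auto)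

text \<open>The substitution r = N - \<alpha> - a - d trades the number of columns paired across for
  the degree of the Laguerre polynomials.\<close>

lemma sum_triangle_shift:
  fixes f :: "nat \<Rightarrow> nat \<Rightarrow> 'a :: comm_monoid_add"
  assumes "\<alpha> \<le> N"
  shows "(\<Sum>a\<le>N - \<alpha>. \<Sum>d\<le>N - \<alpha> - a. f d (N - \<alpha> - a - d)) =
     (\<Sum>d\<le>N - \<alpha>. \<Sum>r | r + \<alpha> + d \<le> N. f d r)"
proof -
  have fin: "finite {r. r + \<alpha> + d \<le> N}" for d by (rule finite_subset[of _ "{..N}"]) auto
  have "(\<Sum>a\<le>N - \<alpha>. \<Sum>d\<le>N - \<alpha> - a. f d (N - \<alpha> - a - d)) =
     (\<Sum>(a, d)\<in>(SIGMA a:{..N - \<alpha>}. {..N - \<alpha> - a}). f d (N - \<alpha> - a - d))"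
    by (simp add: sum.Sigma)
  also have "\<dots> = (\<Sum>(d, r)\<in>(SIGMA d:{..N - \<alpha>}. {r. r + \<alpha> + d \<le> N}). f d r)"
    by (rule sum.reindex_bij_witness[of _ "\<lambda>(d, r). (N - \<alpha> - r - d, d)" "\<lambda>(a, d). (d, N - \<alpha> - a - d)"])
       (use assms in auto)
  also have "\<dots> = (\<Sum>d\<le>N - \<alpha>. \<Sum>r | r + \<alpha> + d \<le> N. f d r)"
    using fin by (simp add: sum.Sigma)
  finally show ?thesis .
qed

text \<open>Summing over \<open>r\<close> innermost isolates \<open>falling_sum\<close>. In the
  power of N, \<alpha> comes from \<open>Z_norm\<close>, 1 from the prefactor 1/N, and p + q from
  the rescaled arguments.\<close>

lemma scaled_laguerre_sum_eq_infsum: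
  fixes x y B :: real
  assumes N: "\<alpha> \<le> N" "0 < N"
  shows "(\<Sum>a\<le>N - \<alpha>. \<Sum>d\<le>N - \<alpha> - a. B ^ d / fact d * (fact (N - a - d) / fact (N - \<alpha> - a - d)) *
        (\<Sum>p\<le>N - \<alpha> - a - d. real ((N - \<alpha> - a - d) choose p) * ((- (x / N)) ^ p / fact (\<alpha> + p))) *
        (\<Sum>q\<le>N - \<alpha> - a - d. real ((N - \<alpha> - a - d) choose q) * ((- (y / N)) ^ q / fact (\<alpha> + q))))
      / real N ^ Suc \<alpha> =
    (\<Sum>\<^sub>\<infinity>(d, p, q). B ^ d / fact d * (bessel_coeff \<alpha> p * x ^ p * (bessel_coeff \<alpha> q * y ^ q)) *
        (falling_sum \<alpha> p q N d / real N ^ Suc (\<alpha> + p + q)))"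
proof -
  let ?m = "N - \<alpha>"
  define L where "L z r = (\<Sum>p\<le>r. real (r choose p) * ((- (z / N)) ^ p / fact (\<alpha> + p)))" for z r
  define u where "u z p = bessel_coeff \<alpha> p * (z / N) ^ p" for z p
  define F where "F r p = fact p * real (r choose p)" for r p
  define R where "R d = {r. r + \<alpha> + d \<le> N}" for d
  have L: "L z r = (\<Sum>p\<le>?m. u z p * F r p)" if "r \<le> ?m" for z r
  proof -
    have "L z r = (\<Sum>p\<le>?m. real (r choose p) * ((- (z / N)) ^ p / fact (\<alpha> + p)))"
      unfolding L_def using that by (intro sum.mono_neutral_left) (auto simp: binomial_eq_0)
    \<comment> \<open>skip\<close>
    also have "\<dots> = (\<Sum>p\<le>?m. u z p * F r p)"
    proof (intro sum.cong refl)
      fix p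
      have "(- (z / N)) ^ p = (- 1) ^ p * (z / N) ^ p"
        by (metis mult_minus1 power_mult_distrib)
      thus "real (r choose p) * ((- (z / N)) ^ p / fact (\<alpha> + p)) = u z p * F r p"
        by (simp add: u_def F_def bessel_coeff_def add.commute)
    qed
    finally show ?thesis .
  qed
  have "(\<Sum>a\<le>?m. \<Sum>d\<le>?m - a. B ^ d / fact d * (fact (N - a - d) / fact (?m - a - d)) *
        L x (?m - a - d) * L y (?m - a - d)) =
     (\<Sum>a\<le>?m. \<Sum>d\<le>?m - a. (\<lambda>d r. B ^ d / fact d * (fact (r + \<alpha>) / fact r) * L x r * L y r) d (?m - a - d))"
  proof (rule sum.cong[OF refl], rule sum.cong[OF refl])
    fix a d assume "a \<in> {..?m}" "d \<in> {..?m - a}"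
    hence "N - a - d = ?m - a - d + \<alpha>" using N by auto
    thus "B ^ d / fact d * (fact (N - a - d) / fact (?m - a - d)) * L x (?m - a - d) * L y (?m - a - d) =
      (\<lambda>d r. B ^ d / fact d * (fact (r + \<alpha>) / fact r) * L x r * L y r) d (?m - a - d)" by simp
  qed
  also have "\<dots> = (\<Sum>d\<le>?m. \<Sum>r\<in>R d. B ^ d / fact d * (fact (r + \<alpha>) / fact r) * L x r * L y r)"
    unfolding R_def by (rule sum_triangle_shift[OF N(1)])
  also have "\<dots> = (\<Sum>d\<le>?m. \<Sum>r\<in>R d. \<Sum>p\<le>?m. \<Sum>q\<le>?m. B ^ d / fact d * (u x p * u y q) *
      (fact (r + \<alpha>) / fact r * F r p * F r q))"
  proof (rule sum.cong[OF refl], rule sum.cong[OF refl])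
    fix d r assume "r \<in> R d"
    hence r: "r \<le> ?m" by (auto simp: R_def)
    have "L x r * L y r = (\<Sum>p\<le>?m. \<Sum>q\<le>?m. u x p * F r p * (u y q * F r q))"
      unfolding L[OF r] by (rule sum_product)
    hence "B ^ d / fact d * (fact (r + \<alpha>) / fact r) * (L x r * L y r) =
      (\<Sum>p\<le>?m. \<Sum>q\<le>?m. B ^ d / fact d * (fact (r + \<alpha>) / fact r) * (u x p * F r p * (u y q * F r q)))"
      by (simp only: sum_distrib_left)
    thus "B ^ d / fact d * (fact (r + \<alpha>) / fact r) * L x r * L y r =
      (\<Sum>p\<le>?m. \<Sum>q\<le>?m. B ^ d / fact d * (u x p * u y q) * (fact (r + \<alpha>) / fact r * F r p * F r q))"
      by (simp only: mult_ac)
  qed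
  also have "\<dots> = (\<Sum>d\<le>?m. \<Sum>p\<le>?m. \<Sum>r\<in>R d. \<Sum>q\<le>?m. B ^ d / fact d * (u x p * u y q) *
      (fact (r + \<alpha>) / fact r * F r p * F r q))"
    by (rule sum.cong[OF refl], rule sum.swap)
  also have "\<dots> = (\<Sum>d\<le>?m. \<Sum>p\<le>?m. \<Sum>q\<le>?m. \<Sum>r\<in>R d. B ^ d / fact d * (u x p * u y q) *
      (fact (r + \<alpha>) / fact r * F r p * F r q))"
    by (rule sum.cong[OF refl], rule sum.cong[OF refl], rule sum.swap)
  also have "\<dots> = (\<Sum>d\<le>?m. \<Sum>p\<le>?m. \<Sum>q\<le>?m. B ^ d / fact d * (u x p * u y q) * falling_sum \<alpha> p q N d)"
    by (simp only: falling_sum_def F_def R_def sum_distrib_left)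
  finally have 1: "(\<Sum>a\<le>?m. \<Sum>d\<le>?m - a. B ^ d / fact d * (fact (N - a - d) / fact (?m - a - d)) *
        L x (?m - a - d) * L y (?m - a - d)) / real N ^ Suc \<alpha> =
     (\<Sum>d\<le>?m. \<Sum>p\<le>?m. \<Sum>q\<le>?m. B ^ d / fact d * (u x p * u y q) * falling_sum \<alpha> p q N d / real N ^ Suc \<alpha>)"
    by (simp only: sum_divide_distrib)
  define G where "G d p q = B ^ d / fact d * (bessel_coeff \<alpha> p * x ^ p * (bessel_coeff \<alpha> q * y ^ q)) *
        (falling_sum \<alpha> p q N d / real N ^ Suc (\<alpha> + p + q))" for d p q
  have 2: "B ^ d / fact d * (u x p * u y q) * falling_sum \<alpha> p q N d / real N ^ Suc \<alpha> = G d p q" for d p q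
    using N by (simp add: G_def u_def power_divide power_add)
  have "(\<Sum>d\<le>?m. \<Sum>p\<le>?m. \<Sum>q\<le>?m. G d p q) = (\<Sum>(d, p, q)\<in>{..?m} \<times> {..?m} \<times> {..?m}. G d p q)"
    by (simp add: sum.cartesian_product split_beta)
  also have "\<dots> = (\<Sum>\<^sub>\<infinity>(d, p, q)\<in>{..?m} \<times> {..?m} \<times> {..?m}. G d p q)"
    by simp
  also have "\<dots> = (\<Sum>\<^sub>\<infinity>(d, p, q). G d p q)"
  proof (rule infsum_cong_neutral)
    fix z :: "nat \<times> nat \<times> nat" assume z: "z \<in> UNIV - {..?m} \<times> {..?m} \<times> {..?m}"
    obtain d p q where [simp]: "z = (d, p, q)" by (cases z)
    \<comment> \<open>Outside the box either no \<open>r\<close> meets the range condition or one of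
      the binomials vanishes, so the sum may run over all triples.\<close>
    have "falling_sum \<alpha> p q N d = 0"
      unfolding falling_sum_def
    proof (rule sum.neutral, rule ballI)
      fix r assume "r \<in> {r. r + \<alpha> + d \<le> N}"
      hence "r < p \<or> r < q" using z by auto
      thus "fact (r + \<alpha>) / fact r * (fact p * real (r choose p)) * (fact q * real (r choose q)) = 0"
        by (auto simp: binomial_eq_0)
    qed
    thus "(case z of (d, p, q) \<Rightarrow> G d p q) = 0" by (simp add: G_def)
  qed auto
  finally show ?thesis using 1 unfolding 2 unfolding L_def G_def by simp
qed

text \<open>The factor 2^(p+q) in the uniform bound is absorbed by doubling the arguments of the
  majorising exponential series.\<close>

lemma scaled_laguerre_sum_tendsto:
  fixes x y B :: real
  shows "(\<lambda>N. \<Sum>\<^sub>\<infinity>(d, p, q). B ^ d / fact d * (bessel_coeff \<alpha> p * x ^ p * (bessel_coeff \<alpha> q * y ^ q)) *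
        (falling_sum \<alpha> p q N d / real N ^ Suc (\<alpha> + p + q))) \<longlonglongrightarrow> exp B * bessel_kernel_series \<alpha> x y"
proof -
  define g where "g = (\<lambda>(d, p, q). B ^ d / fact d * (bessel_coeff \<alpha> p * x ^ p * (bessel_coeff \<alpha> q * y ^ q)) *
      (1 / real (Suc (\<alpha> + p + q))))"
  define bnd where "bnd = (\<lambda>(d, p, q). \<bar>B\<bar> ^ d / fact d * (\<bar>2 * x\<bar> ^ p / fact p * (\<bar>2 * y\<bar> ^ q / fact q)) * 2 ^ Suc \<alpha>)"
  have bnd: "bnd summable_on UNIV"
  proof -
    have "(\<lambda>z. norm (case z of (d, z) \<Rightarrow> \<bar>B\<bar> ^ d / fact d * (case z of (p, q) \<Rightarrow> \<bar>2 * x\<bar> ^ p / fact p * (\<bar>2 * y\<bar> ^ q / fact q)))) summable_on UNIV"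
      by (rule abs_summable_on_times[OF abs_summable_on_exp[of "\<bar>B\<bar>"]
            abs_summable_on_times[OF abs_summable_on_exp[of "\<bar>2 * x\<bar>"] abs_summable_on_exp[of "\<bar>2 * y\<bar>"]]])
    from summable_on_cmult_left[OF abs_summable_summable[OF this], of "2 ^ Suc \<alpha>"]
    show ?thesis by (simp add: bnd_def case_prod_unfold)
  qed
  have "(\<lambda>N. \<Sum>\<^sub>\<infinity>z. (case z of (d, p, q) \<Rightarrow> B ^ d / fact d * (bessel_coeff \<alpha> p * x ^ p * (bessel_coeff \<alpha> q * y ^ q)) *
        (falling_sum \<alpha> p q N d / real N ^ Suc (\<alpha> + p + q)))) \<longlonglongrightarrow> (\<Sum>\<^sub>\<infinity>z. g z)"
  proof (rule infsum_dominated_tendsto[OF _ _ bnd])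
    fix z :: "nat \<times> nat \<times> nat"
    show "(\<lambda>N. case z of (d, p, q) \<Rightarrow> B ^ d / fact d * (bessel_coeff \<alpha> p * x ^ p * (bessel_coeff \<alpha> q * y ^ q)) *
        (falling_sum \<alpha> p q N d / real N ^ Suc (\<alpha> + p + q))) \<longlonglongrightarrow> g z"
      unfolding g_def case_prod_unfold
      by (intro tendsto_mult[OF tendsto_const] falling_sum_scaled_tendsto)
  next
    show "\<forall>\<^sub>F N in sequentially. \<forall>z. norm (case z of (d, p, q) \<Rightarrow> B ^ d / fact d *
        (bessel_coeff \<alpha> p * x ^ p * (bessel_coeff \<alpha> q * y ^ q)) *
        (falling_sum \<alpha> p q N d / real N ^ Suc (\<alpha> + p + q))) \<le> bnd z"
      using eventually_gt_at_top[of 0]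
    proof eventually_elim
      case (elim N)
      show ?case
      proof (intro allI, clarify)
        fix d p q
        have "norm (B ^ d / fact d * (bessel_coeff \<alpha> p * x ^ p * (bessel_coeff \<alpha> q * y ^ q)) *
            (falling_sum \<alpha> p q N d / real N ^ Suc (\<alpha> + p + q))) =
          \<bar>B\<bar> ^ d / fact d * (\<bar>bessel_coeff \<alpha> p * x ^ p\<bar> * \<bar>bessel_coeff \<alpha> q * y ^ q\<bar>) *
            \<bar>falling_sum \<alpha> p q N d / real N ^ Suc (\<alpha> + p + q)\<bar>"
          by (simp add: abs_mult power_abs)
        also have "\<dots> \<le> \<bar>B\<bar> ^ d / fact d * (\<bar>x\<bar> ^ p / fact p * (\<bar>y\<bar> ^ q / fact q)) * 2 ^ Suc (\<alpha> + p + q)"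
          by (intro mult_mono abs_bessel_term_le falling_sum_scaled_bound elim) auto
        also have "\<dots> = bnd (d, p, q)"
          by (simp add: bnd_def power_add power_mult_distrib abs_mult)
        finally show "norm (B ^ d / fact d * (bessel_coeff \<alpha> p * x ^ p * (bessel_coeff \<alpha> q * y ^ q)) *
            (falling_sum \<alpha> p q N d / real N ^ Suc (\<alpha> + p + q))) \<le> bnd (d, p, q)" .
      qed
    qed
  qed simp
  \<comment> \<open>The limit of the scaled \<open>falling_sum\<close> is free of \<open>d\<close>,
    so the triple sum is a product.\<close>
  also have "(\<Sum>\<^sub>\<infinity>z. g z) = (\<Sum>\<^sub>\<infinity>(d, z). B ^ d / fact d * (case z of (p, q) \<Rightarrow>
      bessel_coeff \<alpha> p * x ^ p * (bessel_coeff \<alpha> q * y ^ q) / real (Suc (\<alpha> + p + q))))"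
    by (simp add: g_def case_prod_unfold)
  also have "\<dots> = exp B * bessel_kernel_series \<alpha> x y"
    unfolding bessel_kernel_series_def infsum_exp[symmetric]
    by (rule infsum_times[OF abs_summable_on_exp abs_summable_bessel_kernel_series])
  finally show ?thesis .
qed

subsection \<open>The Bessel kernel as a double power series\<close>

definition bessel_series :: "nat \<Rightarrow> real \<Rightarrow> real" where
  "bessel_series \<alpha> x = (\<Sum>p. bessel_coeff \<alpha> p * x ^ p)"

text \<open>The Euler operator x d/dx applied to \<open>bessel_series\<close>; in this form no
  division by x occurs.\<close>

definition bessel_euler_series :: "nat \<Rightarrow> real \<Rightarrow> real" where
  "bessel_euler_series \<alpha> x = (\<Sum>p. real p * (bessel_coeff \<alpha> p * x ^ p))"

lemma summable_norm_bessel_series: "summable (\<lambda>p. norm (bessel_coeff \<alpha> p * x ^ p))"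
proof (rule summable_comparison_test')
  show "summable (\<lambda>p. \<bar>x\<bar> ^ p / fact p)"
    using abs_summable_on_exp[of "\<bar>x\<bar>"] by (simp add: summable_on_UNIV_nonneg_real_iff)
  show "norm (norm (bessel_coeff \<alpha> p * x ^ p)) \<le> \<bar>x\<bar> ^ p / fact p" if "p \<ge> 0" for p
    using abs_bessel_term_le[of \<alpha> p x] by simp
qed

lemma summable_norm_bessel_euler_series: "summable (\<lambda>p. norm (real p * (bessel_coeff \<alpha> p * x ^ p)))"
proof (rule summable_comparison_test')
  show "summable (\<lambda>p. \<bar>2 * x\<bar> ^ p / fact p)"
    using abs_summable_on_exp[of "\<bar>2 * x\<bar>"] by (simp add: summable_on_UNIV_nonneg_real_iff)
  show "norm (norm (real p * (bessel_coeff \<alpha> p * x ^ p))) \<le> \<bar>2 * x\<bar> ^ p / fact p" if "p \<ge> 0" for p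
  proof -
    \<comment> \<open>Bounding \<open>p\<close> by 2^p lets the extra factor be absorbed by doubling
      the argument.\<close>
    have "real p \<le> 2 ^ p" using of_nat_less_two_power[of p, where 'a = real] by simp
    hence "real p * \<bar>bessel_coeff \<alpha> p * x ^ p\<bar> \<le> 2 ^ p * (\<bar>x\<bar> ^ p / fact p)"
      by (intro mult_mono abs_bessel_term_le) auto
    thus ?thesis by (simp add: abs_mult power_mult_distrib)
  qed
qed

lemma bessel_series_has_sum: "((\<lambda>p. bessel_coeff \<alpha> p * x ^ p) has_sum bessel_series \<alpha> x) UNIV"
  unfolding bessel_series_def
  by (intro norm_summable_imp_has_sum summable_norm_bessel_series summable_sums summable_norm_cancel)

lemma bessel_euler_series_has_sum:
  "((\<lambda>p. real p * (bessel_coeff \<alpha> p * x ^ p)) has_sum bessel_euler_series \<alpha> x) UNIV"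
  unfolding bessel_euler_series_def
  by (intro norm_summable_imp_has_sum summable_norm_bessel_euler_series summable_sums summable_norm_cancel)

lemma has_sum_diff:
  fixes f g :: "'i \<Rightarrow> 'b :: topological_ab_group_add"
  assumes "(f has_sum a) A" "(g has_sum b) A"
  shows "((\<lambda>x. f x - g x) has_sum (a - b)) A"
  using has_sum_add[OF assms(1), of "\<lambda>x. - g x" "- b"] assms(2) by (simp add: has_sum_uminus)

lemma has_sum_times:
  fixes f :: "'i \<Rightarrow> real" and g :: "'j \<Rightarrow> real"
  assumes "(\<lambda>i. norm (f i)) summable_on UNIV" "(\<lambda>j. norm (g j)) summable_on UNIV"
    and "(f has_sum a) UNIV" "(g has_sum b) UNIV"
  shows "((\<lambda>(i, j). f i * g j) has_sum a * b) UNIV"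
proof -
  have "(\<lambda>(i, j). f i * g j) summable_on UNIV"
    using abs_summable_on_times[OF assms(1,2)] by (rule abs_summable_summable)
  thus ?thesis using infsum_times[OF assms(1,2)] assms(3,4) by (simp add: has_sum_iff)
qed

text \<open>The Bessel differential equation in coefficients: with E = x d/dx the series g satisfies
  E (E + \<alpha>) g = - x g.\<close>

lemma bessel_coeff_Suc: "real (Suc p) * real (Suc p + \<alpha>) * bessel_coeff \<alpha> (Suc p) = - bessel_coeff \<alpha> p"
proof -
  have "fact (Suc p + \<alpha>) = real (Suc p + \<alpha>) * fact (p + \<alpha>)" "fact (Suc p) = real (Suc p) * fact p"
    by simp_all
  thus ?thesis unfolding bessel_coeff_def
    by (simp only: power_Suc) (simp add: divide_simps)
qed

text \<open>Multiplication by x raises the first index by one and the recursion rewrites the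
  coefficient. The result lives on positive first indices; the factor \<open>real p\<close> makes
  the terms at \<open>p = 0\<close> vanish.\<close>

lemma bessel_kernel_series_shift_has_sum:
  "((\<lambda>(p, q). - (real p * real (p + \<alpha>)) / real (\<alpha> + p + q) *
      (bessel_coeff \<alpha> p * x ^ p * (bessel_coeff \<alpha> q * y ^ q))) has_sum x * bessel_kernel_series \<alpha> x y) UNIV"
proof -
  let ?g = "\<lambda>(p, q). - (real p * real (p + \<alpha>)) / real (\<alpha> + p + q) *
      (bessel_coeff \<alpha> p * x ^ p * (bessel_coeff \<alpha> q * y ^ q))"
  let ?t = "\<lambda>(p, q). bessel_coeff \<alpha> p * x ^ p * (bessel_coeff \<alpha> q * y ^ q) / real (Suc (\<alpha> + p + q))"
  let ?h = "\<lambda>(p, q). (Suc p, q)"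
  have "(?t has_sum bessel_kernel_series \<alpha> x y) UNIV"
    unfolding bessel_kernel_series_def
    by (rule has_sum_infsum, rule abs_summable_summable, rule abs_summable_bessel_kernel_series)
  hence "((\<lambda>z. x * ?t z) has_sum x * bessel_kernel_series \<alpha> x y) UNIV" by (rule has_sum_cmult_right)
  also have "(\<lambda>z. x * ?t z) = ?g \<circ> ?h"
  proof
    fix z :: "nat \<times> nat"
    obtain p q where [simp]: "z = (p, q)" by (cases z)
    have "(?g \<circ> ?h) z = - (real (Suc p) * real (Suc p + \<alpha>) * bessel_coeff \<alpha> (Suc p)) *
        (x ^ Suc p * (bessel_coeff \<alpha> q * y ^ q)) / real (\<alpha> + Suc p + q)"
      by (simp del: of_nat_Suc of_nat_add power_Suc)
    also have "\<dots> = x * ?t z"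
      unfolding bessel_coeff_Suc by (simp add: mult_ac)
    finally show "x * ?t z = (?g \<circ> ?h) z" ..
  qed
  also have "((?g \<circ> ?h) has_sum x * bessel_kernel_series \<alpha> x y) UNIV \<longleftrightarrow>
      (?g has_sum x * bessel_kernel_series \<alpha> x y) (range ?h)"
    by (rule has_sum_reindex[symmetric]) (auto simp: inj_on_def)
  also have "\<dots> \<longleftrightarrow> (?g has_sum x * bessel_kernel_series \<alpha> x y) UNIV"
  proof (rule has_sum_cong_neutral)
    fix z :: "nat \<times> nat" assume z: "z \<in> UNIV - range ?h"
    obtain p q where [simp]: "z = (p, q)" by (cases z)
    have "p = 0" using z by (cases p) auto
    thus "?g z = 0" by simp
  qed auto
  finally show ?thesis .
qed

lemma bessel_kernel_series_commute: "bessel_kernel_series \<alpha> x y = bessel_kernel_series \<alpha> y x"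
  unfolding bessel_kernel_series_def
  by (rule infsum_reindex_bij_witness[of _ prod.swap prod.swap]) (auto simp: add_ac mult_ac)

text \<open>Comparison of coefficients: by the recursion for the Bessel coefficients, the factor
  \<open>x - y\<close> turns \<open>1 / (\<alpha> + p + q + 1)\<close> into \<open>(q * (q + \<alpha>) - p * (p + \<alpha>)) / (\<alpha> + p + q) = q - p\<close>.\<close>
lemma bessel_kernel_series_eq:
  "(x - y) * bessel_kernel_series \<alpha> x y =
     bessel_series \<alpha> x * bessel_euler_series \<alpha> y - bessel_euler_series \<alpha> x * bessel_series \<alpha> y"
proof -
  let ?a = "\<lambda>p q. bessel_coeff \<alpha> p * x ^ p * (bessel_coeff \<alpha> q * y ^ q)"
  have b: "(\<lambda>p. norm (bessel_coeff \<alpha> p * z ^ p)) summable_on UNIV" for z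
    using summable_norm_bessel_series by (simp add: summable_on_UNIV_nonneg_real_iff)
  have e: "(\<lambda>p. norm (real p * (bessel_coeff \<alpha> p * z ^ p))) summable_on UNIV" for z
    using summable_norm_bessel_euler_series by (simp add: summable_on_UNIV_nonneg_real_iff)
  have "((\<lambda>z. (case z of (p, q) \<Rightarrow> bessel_coeff \<alpha> p * x ^ p * (real q * (bessel_coeff \<alpha> q * y ^ q))) -
         (case z of (p, q) \<Rightarrow> real p * (bessel_coeff \<alpha> p * x ^ p) * (bessel_coeff \<alpha> q * y ^ q))) has_sum
       (bessel_series \<alpha> x * bessel_euler_series \<alpha> y - bessel_euler_series \<alpha> x * bessel_series \<alpha> y)) UNIV"
    by (intro has_sum_diff has_sum_times b e bessel_series_has_sum bessel_euler_series_has_sum)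
  moreover have "((\<lambda>(p, q). - (real q * real (q + \<alpha>)) / real (\<alpha> + p + q) * ?a p q) has_sum
      y * bessel_kernel_series \<alpha> x y) UNIV"
  proof -
    \<comment> \<open>Exchanging the indices reduces this to the shift identity for
      \<open>y\<close>, by symmetry of the series.\<close>
    have "((\<lambda>(p, q). - (real q * real (q + \<alpha>)) / real (\<alpha> + p + q) * ?a p q) has_sum
        y * bessel_kernel_series \<alpha> x y) UNIV \<longleftrightarrow>
      ((\<lambda>(q, p). - (real q * real (q + \<alpha>)) / real (\<alpha> + q + p) *
        (bessel_coeff \<alpha> q * y ^ q * (bessel_coeff \<alpha> p * x ^ p))) has_sum y * bessel_kernel_series \<alpha> y x) UNIV"
      by (rule has_sum_reindex_bij_witness[of _ prod.swap prod.swap])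
         (auto simp: bessel_kernel_series_commute[of \<alpha> x y] add_ac mult_ac)
    thus ?thesis using bessel_kernel_series_shift_has_sum[of \<alpha> y x] by simp
  qed
  from has_sum_diff[OF bessel_kernel_series_shift_has_sum this]
  have "((\<lambda>z. (case z of (p, q) \<Rightarrow> - (real p * real (p + \<alpha>)) / real (\<alpha> + p + q) * ?a p q) -
      (case z of (p, q) \<Rightarrow> - (real q * real (q + \<alpha>)) / real (\<alpha> + p + q) * ?a p q)) has_sum
      (x - y) * bessel_kernel_series \<alpha> x y) UNIV"
    by (simp only: left_diff_distrib)
  moreover have "(\<lambda>z. (case z of (p, q) \<Rightarrow> - (real p * real (p + \<alpha>)) / real (\<alpha> + p + q) * ?a p q) -
      (case z of (p, q) \<Rightarrow> - (real q * real (q + \<alpha>)) / real (\<alpha> + p + q) * ?a p q)) =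
    (\<lambda>z. (case z of (p, q) \<Rightarrow> bessel_coeff \<alpha> p * x ^ p * (real q * (bessel_coeff \<alpha> q * y ^ q))) -
         (case z of (p, q) \<Rightarrow> real p * (bessel_coeff \<alpha> p * x ^ p) * (bessel_coeff \<alpha> q * y ^ q)))"
  proof (rule ext, clarsimp simp only: prod.case split_paired_all)
    fix p q
    show "- (real p * real (p + \<alpha>)) / real (\<alpha> + p + q) * ?a p q - - (real q * real (q + \<alpha>)) / real (\<alpha> + p + q) * ?a p q =
      bessel_coeff \<alpha> p * x ^ p * (real q * (bessel_coeff \<alpha> q * y ^ q)) -
      real p * (bessel_coeff \<alpha> p * x ^ p) * (bessel_coeff \<alpha> q * y ^ q)"
    \<comment> \<open>If the denominator is 0, then p = q = 0 and both sides are 0, division by 0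
      yielding 0.\<close>
    proof (cases "\<alpha> + p + q = 0")
      case False
      have "- (real p * real (p + \<alpha>)) + real q * real (q + \<alpha>) = (real q - real p) * real (\<alpha> + p + q)"
        by (simp add: algebra_simps)
      hence "- (real p * real (p + \<alpha>)) / real (\<alpha> + p + q) + real q * real (q + \<alpha>) / real (\<alpha> + p + q) = real q - real p"
        using False by (simp only: add_divide_distrib[symmetric]) simp
      hence "(- (real p * real (p + \<alpha>)) / real (\<alpha> + p + q) + real q * real (q + \<alpha>) / real (\<alpha> + p + q)) * ?a p q =
          (real q - real p) * ?a p q"
        by (simp only:)
      moreover have "v / s * c - - w / s * c = (v / s + w / s) * c" for v w s c :: real
        by (simp add: distrib_right)
      moreover have "(real q - real p) * ?a p q = bessel_coeff \<alpha> p * x ^ p * (real q * (bessel_coeff \<alpha> q * y ^ q)) -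
          real p * (bessel_coeff \<alpha> p * x ^ p) * (bessel_coeff \<alpha> q * y ^ q)"
        by (simp add: left_diff_distrib)
      ultimately show ?thesis by (simp only:)
    qed simp
  qed
  ultimately show ?thesis using has_sum_unique by (metis (no_types, lifting))
qed

text \<open>Termwise differentiation lowers the exponent and multiplication by x restores it, so the
  identity holds at every x, including 0.\<close>

lemma bessel_series_has_derivative:
  obtains D where "(bessel_series \<alpha> has_real_derivative D) (at x)" "x * D = bessel_euler_series \<alpha> x"
proof
  let ?D = "\<Sum>n. diffs (bessel_coeff \<alpha>) n * x ^ n"
  show "(bessel_series \<alpha> has_real_derivative ?D) (at x)"
    unfolding bessel_series_def[abs_def]
    by (rule termdiffs_strong_converges_everywhere) (rule summable_norm_cancel[OF summable_norm_bessel_series])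
  have s: "summable (\<lambda>p. real p * (bessel_coeff \<alpha> p * x ^ p))"
    by (rule summable_norm_cancel[OF summable_norm_bessel_euler_series])
  have "summable (\<lambda>n. diffs (bessel_coeff \<alpha>) n * x ^ n)"
    by (rule termdiff_converges_all) (rule summable_norm_cancel[OF summable_norm_bessel_series])
  hence "x * ?D = (\<Sum>n. x * (diffs (bessel_coeff \<alpha>) n * x ^ n))" by (rule suminf_mult[symmetric])
  also have "\<dots> = (\<Sum>n. real (Suc n) * (bessel_coeff \<alpha> (Suc n) * x ^ Suc n))"
    by (simp add: diffs_def mult_ac)
  also have "\<dots> = bessel_euler_series \<alpha> x"
    unfolding bessel_euler_series_def using suminf_split_head[OF s] by simp
  finally show "x * ?D = bessel_euler_series \<alpha> x" .
qed

section \<open>From the power series to Bessel functions and their kernel\<close>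

lemma bessel_J_eq: "bessel_J \<alpha> u = (u / 2) ^ \<alpha> * bessel_series \<alpha> (u\<^sup>2 / 4)"
proof -
  have "(- 1) ^ k / (fact k * fact (k + \<alpha>)) * (u / 2) ^ (2 * k + \<alpha>) =
      (u / 2) ^ \<alpha> * (bessel_coeff \<alpha> k * (u\<^sup>2 / 4) ^ k)" for k
  proof -
    have "(u / 2) ^ (2 * k) = (u\<^sup>2 / 4) ^ k" by (simp add: power_mult power_divide)
    thus ?thesis by (simp add: bessel_coeff_def power_add)
  qed
  thus ?thesis unfolding bessel_J_def bessel_series_def
    by (simp add: suminf_mult summable_norm_cancel[OF summable_norm_bessel_series])
qed

text \<open>The operator u d/du multiplies (u/2)^\<alpha> by \<alpha> and acts as 2 x d/dx on
  functions of x = u^2/4. The kernel contains the derivative only in this combination.\<close>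

lemma bessel_J_deriv:
  "u * deriv (bessel_J \<alpha>) u =
     (u / 2) ^ \<alpha> * (real \<alpha> * bessel_series \<alpha> (u\<^sup>2 / 4) + 2 * bessel_euler_series \<alpha> (u\<^sup>2 / 4))"
proof -
  obtain D where D: "(bessel_series \<alpha> has_real_derivative D) (at (u\<^sup>2 / 4))"
    "u\<^sup>2 / 4 * D = bessel_euler_series \<alpha> (u\<^sup>2 / 4)"
    by (rule bessel_series_has_derivative)
  have "((\<lambda>u. (u / 2) ^ \<alpha> * bessel_series \<alpha> (u\<^sup>2 / 4)) has_real_derivative
     (real \<alpha> * (u / 2) ^ (\<alpha> - 1) * (1 / 2)) * bessel_series \<alpha> (u\<^sup>2 / 4) + (D * (u / 2)) * (u / 2) ^ \<alpha>) (at u)"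
  proof (rule DERIV_mult)
    show "((\<lambda>u. (u / 2) ^ \<alpha>) has_real_derivative real \<alpha> * (u / 2) ^ (\<alpha> - 1) * (1 / 2)) (at u)"
      by (auto intro!: derivative_eq_intros)
    show "((\<lambda>u. bessel_series \<alpha> (u\<^sup>2 / 4)) has_real_derivative D * (u / 2)) (at u)"
      by (rule DERIV_chain2[where f = "bessel_series \<alpha>" and g = "\<lambda>u. u\<^sup>2 / 4", OF D(1)]) (auto intro!: derivative_eq_intros)
  qed
  hence "deriv (bessel_J \<alpha>) u = (real \<alpha> * (u / 2) ^ (\<alpha> - 1) * (1 / 2)) * bessel_series \<alpha> (u\<^sup>2 / 4) +
      (D * (u / 2)) * (u / 2) ^ \<alpha>"
    unfolding bessel_J_eq[abs_def] by (rule DERIV_imp_deriv)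
  hence "u * deriv (bessel_J \<alpha>) u = (real \<alpha> * ((u / 2) ^ (\<alpha> - 1) * (u / 2))) * bessel_series \<alpha> (u\<^sup>2 / 4) +
      2 * (u\<^sup>2 / 4 * D) * (u / 2) ^ \<alpha>"
    by (simp add: algebra_simps power2_eq_square)
  \<comment> \<open>For \<alpha> = 0 the exponent \<open>\<alpha> - 1\<close> is truncated, but the
    coefficient is 0.\<close>
  also have "real \<alpha> * ((u / 2) ^ (\<alpha> - 1) * (u / 2)) = real \<alpha> * (u / 2) ^ \<alpha>"
    by (cases \<alpha>) simp_all
  finally show ?thesis unfolding D(2) by (simp add: algebra_simps)
qed

text \<open>The terms with coefficient \<alpha> cancel by antisymmetry. The 2 from the Euler
  operator cancels the one in the denominator, and the final 1/4 is the ratio of s/4 - t/4 to s -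
  t.\<close>

lemma bessel_quotient_eq:
  assumes "0 < s" "0 < t" "s \<noteq> t"
  shows "bessel_quotient \<alpha> s t = (sqrt (s / 4) * sqrt (t / 4)) ^ \<alpha> * bessel_kernel_series \<alpha> (s / 4) (t / 4) / 4"
proof -
  let ?P = "(sqrt s / 2) ^ \<alpha> * (sqrt t / 2) ^ \<alpha>"
  let ?g = "bessel_series \<alpha>" and ?h = "bessel_euler_series \<alpha>"
  have "bessel_J \<alpha> (sqrt s) * sqrt t * deriv (bessel_J \<alpha>) (sqrt t)
      - sqrt s * deriv (bessel_J \<alpha>) (sqrt s) * bessel_J \<alpha> (sqrt t) =
    bessel_J \<alpha> (sqrt s) * (sqrt t * deriv (bessel_J \<alpha>) (sqrt t))
      - (sqrt s * deriv (bessel_J \<alpha>) (sqrt s)) * bessel_J \<alpha> (sqrt t)" by simp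
  also have "\<dots> = ?P * 2 * (?g (s / 4) * ?h (t / 4) - ?h (s / 4) * ?g (t / 4))"
    unfolding bessel_J_deriv bessel_J_eq using assms by (simp add: algebra_simps)
  also have "\<dots> = ?P * 2 * ((s / 4 - t / 4) * bessel_kernel_series \<alpha> (s / 4) (t / 4))"
    unfolding bessel_kernel_series_eq ..
  finally have "bessel_quotient \<alpha> s t = ?P * 2 * ((s / 4 - t / 4) * bessel_kernel_series \<alpha> (s / 4) (t / 4)) / (2 * (s - t))"
    by (simp only: bessel_quotient_def)
  also have "\<dots> = ?P * bessel_kernel_series \<alpha> (s / 4) (t / 4) / 4"
    using assms by (simp add: field_simps)
  also have "?P = (sqrt (s / 4) * sqrt (t / 4)) ^ \<alpha>"
    by (simp add: real_sqrt_divide flip: power_mult_distrib)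
  finally show ?thesis .
qed

text \<open>Joint continuity: near the limit the arguments are bounded by |x| + 1 and |y| + 1, which
  gives a fixed summable majorant.\<close>

lemma bessel_kernel_series_tendsto:
  assumes f: "(f \<longlongrightarrow> x) F" and g: "(g \<longlongrightarrow> y) F" and F: "F \<noteq> bot"
  shows "((\<lambda>z. bessel_kernel_series \<alpha> (f z) (g z)) \<longlongrightarrow> bessel_kernel_series \<alpha> x y) F"
  unfolding bessel_kernel_series_def
proof (rule infsum_dominated_tendsto[OF _ _ summable_on_exp_product[of "\<bar>x\<bar> + 1" "\<bar>y\<bar> + 1"] F])
  fix z :: "nat \<times> nat"
  show "((\<lambda>w. case z of (p, q) \<Rightarrow> bessel_coeff \<alpha> p * f w ^ p * (bessel_coeff \<alpha> q * g w ^ q) / real (Suc (\<alpha> + p + q)))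
      \<longlongrightarrow> (case z of (p, q) \<Rightarrow> bessel_coeff \<alpha> p * x ^ p * (bessel_coeff \<alpha> q * y ^ q) / real (Suc (\<alpha> + p + q)))) F"
    unfolding case_prod_unfold by (intro tendsto_intros f g) auto
next
  have "\<forall>\<^sub>F w in F. \<bar>f w\<bar> < \<bar>x\<bar> + 1" by (rule order_tendstoD[OF tendsto_rabs[OF f]]) simp
  moreover have "\<forall>\<^sub>F w in F. \<bar>g w\<bar> < \<bar>y\<bar> + 1" by (rule order_tendstoD[OF tendsto_rabs[OF g]]) simp
  ultimately show "\<forall>\<^sub>F w in F. \<forall>z. norm (case z of (p, q) \<Rightarrow>
      bessel_coeff \<alpha> p * f w ^ p * (bessel_coeff \<alpha> q * g w ^ q) / real (Suc (\<alpha> + p + q))) \<le>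
    (case z of (p, q) \<Rightarrow> \<bar>\<bar>x\<bar> + 1\<bar> ^ p / fact p * (\<bar>\<bar>y\<bar> + 1\<bar> ^ q / fact q))"
  proof eventually_elim
    case (elim w)
    show ?case
    proof (intro allI, clarify)
      fix p q
      have "norm (bessel_coeff \<alpha> p * f w ^ p * (bessel_coeff \<alpha> q * g w ^ q) / real (Suc (\<alpha> + p + q))) \<le>
          \<bar>f w\<bar> ^ p / fact p * (\<bar>g w\<bar> ^ q / fact q)"
        using abs_bessel_kernel_term_le[of \<alpha> p "f w" q "g w"] by simp
      also have "\<dots> \<le> \<bar>\<bar>x\<bar> + 1\<bar> ^ p / fact p * (\<bar>\<bar>y\<bar> + 1\<bar> ^ q / fact q)"
        using elim by (intro mult_mono divide_right_mono power_mono) auto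
      finally show "norm (bessel_coeff \<alpha> p * f w ^ p * (bessel_coeff \<alpha> q * g w ^ q) / real (Suc (\<alpha> + p + q))) \<le>
          \<bar>\<bar>x\<bar> + 1\<bar> ^ p / fact p * (\<bar>\<bar>y\<bar> + 1\<bar> ^ q / fact q)" .
    qed
  qed
qed

text \<open>On the diagonal, the right side is continuous and agrees with the quotient at all
  off-diagonal points of the quadrant, so it is the continuous extension.\<close>

lemma bessel_kernel_eq:
  assumes "0 < x" "0 < y"
  shows "bessel_kernel \<alpha> x y = (sqrt (x / 4) * sqrt (y / 4)) ^ \<alpha> * bessel_kernel_series \<alpha> (x / 4) (y / 4) / 4"
proof (cases "x = y")
  case False
  thus ?thesis using bessel_quotient_eq assms by (simp add: bessel_kernel_def)
next
  case True
  let ?A = "{(s, t). 0 < s \<and> 0 < t \<and> s \<noteq> t} :: (real \<times> real) set"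
  let ?F = "at (x, x) within ?A"
  \<comment> \<open>A limit is unique only along a nontrivial filter; points shifted in one
    coordinate approach \<open>(x, x)\<close> inside the quadrant and off the diagonal.\<close>
  have F: "?F \<noteq> bot"
    unfolding trivial_limit_within islimpt_approachable not_not
  proof (intro allI impI)
    fix e :: real assume "0 < e"
    thus "\<exists>z\<in>?A. z \<noteq> (x, x) \<and> dist z (x, x) < e"
      using assms by (intro bexI[of _ "(x + e / 2, x)"]) (auto simp: dist_Pair_Pair dist_real_def)
  qed
  have "((\<lambda>z. fst z) \<longlongrightarrow> x) ?F" "((\<lambda>z. snd z) \<longlongrightarrow> x) ?F"
    by (auto intro!: tendsto_eq_intros)
  hence "((\<lambda>z. (sqrt (fst z / 4) * sqrt (snd z / 4)) ^ \<alpha> * bessel_kernel_series \<alpha> (fst z / 4) (snd z / 4) / 4) \<longlongrightarrow>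
      (sqrt (x / 4) * sqrt (x / 4)) ^ \<alpha> * bessel_kernel_series \<alpha> (x / 4) (x / 4) / 4) ?F"
    by (intro tendsto_intros bessel_kernel_series_tendsto F) auto
  also have "?this \<longleftrightarrow> ((\<lambda>(s, t). bessel_quotient \<alpha> s t) \<longlongrightarrow>
      (sqrt (x / 4) * sqrt (x / 4)) ^ \<alpha> * bessel_kernel_series \<alpha> (x / 4) (x / 4) / 4) ?F"
    by (intro tendsto_cong, unfold eventually_at_filter, intro always_eventually)
       (auto simp: bessel_quotient_eq)
  finally have "Lim ?F (\<lambda>(s, t). bessel_quotient \<alpha> s t) =
      (sqrt (x / 4) * sqrt (x / 4)) ^ \<alpha> * bessel_kernel_series \<alpha> (x / 4) (x / 4) / 4"
    by (rule tendsto_Lim[OF F])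
  moreover have "bessel_kernel \<alpha> x x = Lim ?F (\<lambda>(s, t). bessel_quotient \<alpha> s t)"
    by (simp add: bessel_kernel_def)
  ultimately show ?thesis unfolding True[symmetric] by (simp only:)
qed

subsection \<open>The limit\<close>

lemma Z_norm_eq:
  assumes "0 < x" "0 < y" "0 < N"
  shows "Z_norm \<alpha> N x y = (sqrt x * sqrt y) ^ \<alpha> / real N ^ \<alpha>"
proof -
  have a: "0 < x * y / (real N)\<^sup>2" using assms by simp
  have "Z_norm \<alpha> N x y = ((x * y / (real N)\<^sup>2) powr (1 / 2)) powr real \<alpha>"
    by (simp add: Z_norm_def powr_powr)
  also have "\<dots> = sqrt (x * y / (real N)\<^sup>2) ^ \<alpha>"
    using a by (simp only: powr_half_sqrt less_imp_le powr_realpow real_sqrt_gt_zero)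
  also have "sqrt (x * y / (real N)\<^sup>2) = sqrt x * sqrt y / real N"
    by (simp add: real_sqrt_divide real_sqrt_mult)
  finally show ?thesis by (simp add: power_divide)
qed

theorem theorem6p1:
  fixes Q :: "real measure" and b :: real
    and M :: "nat \<Rightarrow> nat \<Rightarrow> 'w measure"
    and X :: "nat \<Rightarrow> nat \<Rightarrow> 'w \<Rightarrow> complex mat"
    and \<alpha> :: nat and \<mu> \<nu> :: real
  assumes Q: "real_distribution Q"
    and fourth_moment: "integrable Q (\<lambda>x. x ^ 4)" "b = (\<integral>x. x ^ 4 \<partial>Q)"
    and mean: "prob_space.expectation Q (\<lambda>x. x) = 0"
    and variance: "prob_space.variance Q (\<lambda>x. x) = 1 / 2"
    and X: "\<And>n m. m \<le> n \<Longrightarrow> iid_complex_matrix Q (M n m) n m (X n m)"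
    and pos: "0 < \<mu>" "0 < \<nu>"
  shows "(\<lambda>N. complex_of_real (1 / 4 * (1 / real N) * Z_norm \<alpha> N (\<mu> / 4) (\<nu> / 4)) *
              (char_poly_correlation M X N (N - \<alpha>)
                 (complex_of_real (\<mu> / (4 * real N))) (complex_of_real (\<nu> / (4 * real N)))
               / (fact N * fact (N - \<alpha>))))
         \<longlonglongrightarrow> complex_of_real (exp (2 * (b - 3 / 4)) * bessel_kernel \<alpha> \<mu> \<nu>)"
proof -
  define B where "B = 2 * (b - 3 / 4)"
  define x where "x = \<mu> / 4"
  define y where "y = \<nu> / 4"
  have xy: "0 < x" "0 < y" using pos by (auto simp: x_def y_def)
  define S where "S N = (\<Sum>a\<le>N - \<alpha>. \<Sum>d\<le>N - \<alpha> - a. B ^ d / fact d * (fact (N - a - d) / fact (N - \<alpha> - a - d)) *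
        (\<Sum>p\<le>N - \<alpha> - a - d. real ((N - \<alpha> - a - d) choose p) * ((- (x / N)) ^ p / fact (\<alpha> + p))) *
        (\<Sum>q\<le>N - \<alpha> - a - d. real ((N - \<alpha> - a - d) choose q) * ((- (y / N)) ^ q / fact (\<alpha> + q))))" for N
  \<comment> \<open>The 1/4 of the normalisation is the one relating the series to the Bessel
    kernel; the power is what \<open>Z_norm\<close> leaves once N^\<alpha> is split off.\<close>
  define k where "k = (sqrt x * sqrt y) ^ \<alpha> / 4"
  have "(\<lambda>N. complex_of_real (k * (\<Sum>\<^sub>\<infinity>(d, p, q). B ^ d / fact d *
      (bessel_coeff \<alpha> p * x ^ p * (bessel_coeff \<alpha> q * y ^ q)) *
      (falling_sum \<alpha> p q N d / real N ^ Suc (\<alpha> + p + q))))) \<longlonglongrightarrow>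
    complex_of_real (k * (exp B * bessel_kernel_series \<alpha> x y))"
    by (intro tendsto_of_real tendsto_mult tendsto_const scaled_laguerre_sum_tendsto)
  also have "k * (exp B * bessel_kernel_series \<alpha> x y) = exp (2 * (b - 3 / 4)) * bessel_kernel \<alpha> \<mu> \<nu>"
    unfolding bessel_kernel_eq[OF pos] by (simp add: k_def B_def x_def y_def)
  finally show ?thesis
  proof (rule Lim_transform_eventually)
    show "\<forall>\<^sub>F N in sequentially. complex_of_real (k * (\<Sum>\<^sub>\<infinity>(d, p, q). B ^ d / fact d *
        (bessel_coeff \<alpha> p * x ^ p * (bessel_coeff \<alpha> q * y ^ q)) *
        (falling_sum \<alpha> p q N d / real N ^ Suc (\<alpha> + p + q)))) =
      complex_of_real (1 / 4 * (1 / real N) * Z_norm \<alpha> N (\<mu> / 4) (\<nu> / 4)) *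
        (char_poly_correlation M X N (N - \<alpha>)
           (complex_of_real (\<mu> / (4 * real N))) (complex_of_real (\<nu> / (4 * real N)))
         / (fact N * fact (N - \<alpha>)))"
      \<comment> \<open>For N < \<alpha> the dimension \<open>N - \<alpha>\<close> is truncated, and
        N = 0 admits no division; neither affects the limit.\<close>
      using eventually_ge_at_top[of \<alpha>] eventually_gt_at_top[of 0]
    proof eventually_elim
      case (elim N)
      have m: "N - \<alpha> \<le> N" "N - (N - \<alpha>) = \<alpha>" using elim by auto
      have arg: "complex_of_real (\<mu> / (4 * real N)) = complex_of_real (x / N)"
        "complex_of_real (\<nu> / (4 * real N)) = complex_of_real (y / N)"
        by (simp_all add: x_def y_def)
      have "char_poly_correlation M X N (N - \<alpha>) (complex_of_real (\<mu> / (4 * real N)))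
          (complex_of_real (\<nu> / (4 * real N))) = fact N * fact (N - \<alpha>) * complex_of_real (S N)"
        unfolding arg char_poly_correlation_eq[where M = M and X = X, OF X[OF m(1)] m(1) fourth_moment(1) mean variance] m(2)
        unfolding S_def B_def fourth_moment(2) by simp
      hence f: "char_poly_correlation M X N (N - \<alpha>) (complex_of_real (\<mu> / (4 * real N)))
          (complex_of_real (\<nu> / (4 * real N))) / (fact N * fact (N - \<alpha>)) = complex_of_real (S N)"
        by simp
      have "1 / 4 * (1 / real N) * Z_norm \<alpha> N x y * S N = k * (S N / real N ^ Suc \<alpha>)"
        using Z_norm_eq[OF xy elim(2)] by (simp add: k_def)
      also have "S N / real N ^ Suc \<alpha> = (\<Sum>\<^sub>\<infinity>(d, p, q). B ^ d / fact d *
          (bessel_coeff \<alpha> p * x ^ p * (bessel_coeff \<alpha> q * y ^ q)) *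
          (falling_sum \<alpha> p q N d / real N ^ Suc (\<alpha> + p + q)))"
        unfolding S_def by (rule scaled_laguerre_sum_eq_infsum[OF elim])
      finally show ?case
        unfolding f of_real_mult[symmetric] x_def[symmetric] y_def[symmetric] by simp
    qed
  qed
qed

end
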